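(* If $G$ is a connected planar graph of order $n\geq 2$ with no vertex of degree five, then $b_{dR}(G)\leq 7$.
   Context: All graphs are finite, simple and undirected. For a graph $G=(V,E)$, a double Roman dominating function (DRDF) is a function $f:V\to\{0,1,2,3\}$ such that every vertex $v$ with $f(v)=0$ has at least two neighbors $u$ with $f(u)=2$ or at least one neighbor $w$ with $f(w)=3$, and every vertex $v$ with $f(v)=1$ has at least one neighbor $w$ with $f(w)\geq 2$. The weight of $f$ is $\sum_{u\in V}f(u)$, and $\gamma_{dR}(G)$ is the minimum weight of a DRDF on $G$. The double Roman bondage number $b_{dR}(G)$ is the minimum cardinality of an edge set $B\subseteq E(G)$ such that $\gamma_{dR}(G-B)>\gamma_{dR}(G)$. *)

theory Defs
  imports "HOL-Analysis.Analysis" "HOL-Library.Extended_Nat"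
begin

definition simple_graph :: "'a set \<Rightarrow> 'a set set \<Rightarrow> bool" where
  "simple_graph V E \<longleftrightarrow> finite V \<and> (\<forall>e\<in>E. e \<subseteq> V \<and> card e = 2)"

definition neighbors :: "'a set set \<Rightarrow> 'a \<Rightarrow> 'a set" where
  "neighbors E v = {u. u \<noteq> v \<and> {u, v} \<in> E}"

definition vertex_degree :: "'a set set \<Rightarrow> 'a \<Rightarrow> nat" where
  "vertex_degree E v = card (neighbors E v)"

definition graph_connected :: "'a set \<Rightarrow> 'a set set \<Rightarrow> bool" where
  "graph_connected V E \<longleftrightarrow>
     V \<noteq> {} \<and> (\<forall>u\<in>V. \<forall>v\<in>V. (u, v) \<in> {(x, y). {x, y} \<in> E}\<^sup>*)"

text \<open>
  A drawing in the plane, identified with the type of complex numbers: \<open>p\<close> places the vertices and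
  \<open>c e\<close> parametrises the edge \<open>e\<close> as a (not necessarily smooth or polygonal) Jordan arc between
  the points of its ends. Edges pass through no other vertices and meet only at common ends.
\<close>

definition plane_drawing ::
    "'a set \<Rightarrow> 'a set set \<Rightarrow> ('a \<Rightarrow> complex) \<Rightarrow> ('a set \<Rightarrow> real \<Rightarrow> complex) \<Rightarrow> bool" where
  "plane_drawing V E p c \<longleftrightarrow>
     inj_on p V \<and>
     (\<forall>e\<in>E. arc (c e) \<and> {pathstart (c e), pathfinish (c e)} = p ` e
            \<and> path_image (c e) \<inter> p ` V = p ` e) \<and>
     (\<forall>e\<in>E. \<forall>e'\<in>E. e \<noteq> e' \<longrightarrow>
        path_image (c e) \<inter> path_image (c e') = p ` (e \<inter> e'))"

definition planar_graph :: "'a set \<Rightarrow> 'a set set \<Rightarrow> bool" where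
  "planar_graph V E \<longleftrightarrow> (\<exists>p c. plane_drawing V E p c)"

definition DRDF :: "'a set \<Rightarrow> 'a set set \<Rightarrow> ('a \<Rightarrow> nat) \<Rightarrow> bool" where
  "DRDF V E f \<longleftrightarrow>
     (\<forall>v\<in>V. f v \<in> {0, 1, 2, 3}) \<and>
     (\<forall>v\<in>V. f v = 0 \<longrightarrow>
        2 \<le> card {u \<in> neighbors E v. f u = 2} \<or> (\<exists>w\<in>neighbors E v. f w = 3)) \<and>
     (\<forall>v\<in>V. f v = 1 \<longrightarrow> (\<exists>w\<in>neighbors E v. 2 \<le> f w))"

definition gamma_dR :: "'a set \<Rightarrow> 'a set set \<Rightarrow> nat" where
  "gamma_dR V E = (LEAST w. \<exists>f. DRDF V E f \<and> w = (\<Sum>u\<in>V. f u))"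

text \<open>The minimum is taken in \<open>enat\<close>, so that it is \<open>\<infinity>\<close>, not \<open>0\<close>, if no suitable edge set exists.\<close>

definition b_dR :: "'a set \<Rightarrow> 'a set set \<Rightarrow> enat" where
  "b_dR V E = (INF B \<in> {B. B \<subseteq> E \<and> gamma_dR V E < gamma_dR V (E - B)}. enat (card B))"

lemma DRDF_const_2: "DRDF V E (\<lambda>_. 2)"
  by (simp add: DRDF_def)

lemma gamma_dR_attained: "\<exists>f. DRDF V E f \<and> gamma_dR V E = (\<Sum>u\<in>V. f u)"
  unfolding gamma_dR_def by (rule LeastI_ex) (use DRDF_const_2 in blast)

lemma gamma_dR_le: "DRDF V E f \<Longrightarrow> gamma_dR V E \<le> (\<Sum>u\<in>V. f u)"
  unfolding gamma_dR_def by (rule Least_le) blast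

end

theory Submission
  imports Defs
begin

text \<open>
  Deleting the edges at \<open>y\<close>, and those edges at a neighbour \<open>x\<close> of \<open>y\<close> that do not lead to a common
  neighbour, makes \<open>y\<close> cost at least 2; back in \<open>G\<close> one can either raise \<open>x\<close> to 3 or give \<open>y\<close> the
  value of \<open>x\<close>, which is cheaper. So \<open>b_dR\<close> is at most \<open>d(x) + d(y) - 1 - |N(x) \<inter> N(y)|\<close> for adjacent
  \<open>x\<close>, \<open>y\<close>, and similarly at most \<open>d(x) + d(y) - 1\<close> if \<open>x\<close> and \<open>y\<close> have a common neighbour.
  If \<open>b_dR \<ge> 8\<close>, the vertices of degree at most 4 are therefore independent with disjoint
  neighbourhoods. Contracting each of them into a neighbour with which it has the fewest common
  neighbours gives a minor with \<open>m \<ge> 3n\<close>.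

  Instead of Euler's formula we use that a graph without \<open>K\<^sub>3\<^sub>,\<^sub>3\<close> minor has \<open>m \<le> 3n - 5\<close>. In a
  counterexample with \<open>n\<close> minimal and \<open>m = 3n - 4\<close> every edge lies in three triangles, so a vertex of
  degree at most 5 yields a \<open>K\<^sub>3\<^sub>,\<^sub>3\<close> or lies in a \<open>K\<^sub>5\<close>, along which the graph splits as a 2-sum.
  That a plane graph has no \<open>K\<^sub>3\<^sub>,\<^sub>3\<close> minor follows from the fact that no face of a plane theta
  graph touches the interiors of all three arcs, a consequence of Janiszewski's theorem.
\<close>

section \<open>Theta graphs in the plane\<close>

text \<open>By the Jordan curve theorem the complement of \<open>c\<close> \<union> \<open>d\<close>
  has two components. The open arc of \<open>e\<close> is connected and avoids the curve, so it lies
  in one of them, and \<open>U\<close> is the other. The last two properties record that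
  \<open>U\<close> is a whole component and that only one other component is left.\<close>

lemma theta_graph_face:
  fixes c d e :: "real \<Rightarrow> complex"
  assumes "arc c" "arc d" "arc e"
    and "pathstart c = a" "pathfinish c = b" "pathstart d = a" "pathfinish d = b"
    and "pathstart e = a" "pathfinish e = b"
    and cd: "path_image c \<inter> path_image d = {a, b}"
    and ce: "path_image c \<inter> path_image e = {a, b}"
    and de: "path_image d \<inter> path_image e = {a, b}"
  obtains U where "connected U" "U \<noteq> {}" "frontier U = path_image c \<union> path_image d"
    "U \<inter> (path_image c \<union> path_image d \<union> path_image e) = {}"
    "\<And>z w. z \<in> U \<Longrightarrow> connected_component (- (path_image c \<union> path_image d)) z w \<Longrightarrow> w \<in> U"
    "\<And>z w. z \<notin> path_image c \<union> path_image d \<Longrightarrow> z \<notin> U \<Longrightarrow> w \<in> path_image e - {a, b} \<Longrightarrow>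
       connected_component (- (path_image c \<union> path_image d)) z w"
proof -
  define J where "J = path_image c \<union> path_image d"
  define e' where "e' = path_image e - {a, b}"
  define g where "g = c +++ reversepath d"
  have sg: "simple_path g" "pathfinish g = pathstart g" and Jg: "path_image g = J"
    using assms by (auto simp: g_def J_def path_image_join arc_reversepath intro!: simple_path_join_loop)
  note face = that
  note Jordan = Jordan_inside_outside [OF sg, unfolded Jg]
  have e'_con: "connected e'" and e'_J: "e' \<inter> J = {}"
    using connected_simple_path_endless[of e] assms arc_imp_simple_path[of e]
    by (auto simp: e'_def J_def)
  have e'_ne: "e' \<noteq> {}"
    using nonempty_simple_path_endless[of e] assms arc_imp_simple_path[of e] by (auto simp: e'_def)
  \<comment> \<open>Stated for two abstract sides, \<open>W\<close> being the one that holds the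
    open arc, since inside and outside may come in either order.\<close>
  have *: thesis if U: "connected U" "U \<noteq> {}" "frontier U = J" "open U" and W: "connected W" "open W"
     and UW: "U \<inter> W = {}" "U \<union> W = - J" and eW: "e' \<subseteq> W" for U W
  proof (rule face[OF U(1,2) U(3)[unfolded J_def]])
    show "U \<inter> (path_image c \<union> path_image d \<union> path_image e) = {}"
      using eW UW ce cd unfolding e'_def J_def by blast
    fix z w
    show "w \<in> U" if z: "z \<in> U" and zw: "connected_component (- (path_image c \<union> path_image d)) z w"
    proof (rule ccontr)
      assume w: "w \<notin> U"
      obtain T where T: "connected T" "T \<subseteq> - J" "z \<in> T" "w \<in> T"
        using zw unfolding connected_component_def J_def by blast
      have "w \<in> W" using T w UW by blast
      have "U \<inter> T = {} \<or> W \<inter> T = {}"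
        using connectedD[OF T(1) U(4) W(2)] T UW by blast
      then show False using T z \<open>w \<in> W\<close> by blast
    qed
    show "connected_component (- (path_image c \<union> path_image d)) z w"
      if "z \<notin> path_image c \<union> path_image d" "z \<notin> U" "w \<in> path_image e - {a, b}"
    proof -
      have "z \<in> W" "w \<in> W" "W \<subseteq> - J" using that UW eW unfolding e'_def J_def by blast+
      then show ?thesis using W(1) unfolding connected_component_def J_def by blast
    qed
  qed
  have "inside J \<inter> e' = {} \<or> outside J \<inter> e' = {}"
    using connectedD[OF e'_con, of "inside J" "outside J"] Jordan e'_J by blast
  then have "e' \<subseteq> outside J \<or> e' \<subseteq> inside J"
    using Jordan e'_J by blast
  then show ?thesis
  proof
    assume "e' \<subseteq> outside J"
    then show ?thesis using *[of "inside J" "outside J"] Jordan by blast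
  next
    assume "e' \<subseteq> inside J"
    then show ?thesis using *[of "outside J" "inside J"] Jordan by blast
  qed
qed

text \<open>Each pair of arcs has a face avoiding the third; call these \<open>U1\<close>,
  \<open>U2\<close>, \<open>U3\<close>. As \<open>C\<close> reaches all three open arcs, it lies in
  none of them. Hence a point \<open>z\<close> of \<open>C\<close> can be joined to a point
  \<open>o1\<close> of \<open>U1\<close> off \<open>c\<close> \<union> \<open>e\<close> by way of
  \<open>d\<close>, and off \<open>d\<close> \<union> \<open>e\<close> by way of \<open>c\<close>.
  These two sets meet in the connected set \<open>e\<close>, so by Janiszewski's theorem their union
  does not separate \<open>z\<close> from \<open>o1\<close> either, which puts \<open>z\<close> into
  \<open>U1\<close>.\<close>

lemma theta_graph_face_meets_two_arcs:
  fixes c d e :: "real \<Rightarrow> complex"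
  assumes "arc c" "arc d" "arc e"
    and "pathstart c = a" "pathfinish c = b" "pathstart d = a" "pathfinish d = b"
    and "pathstart e = a" "pathfinish e = b"
    and cd: "path_image c \<inter> path_image d = {a, b}"
    and ce: "path_image c \<inter> path_image e = {a, b}"
    and de: "path_image d \<inter> path_image e = {a, b}"
    and C: "connected C" "C \<noteq> {}" "C \<inter> (path_image c \<union> path_image d \<union> path_image e) = {}"
    and touch: "closure C \<inter> (path_image c - {a, b}) \<noteq> {}"
      "closure C \<inter> (path_image d - {a, b}) \<noteq> {}"
      "closure C \<inter> (path_image e - {a, b}) \<noteq> {}"
  shows False
proof -
  \<comment> \<open>A connected set that meets the face \<open>U\<close> and avoids its boundary
    \<open>S\<close> stays in \<open>U\<close>; its closure then lies in \<open>U\<close> \<union>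
    \<open>S\<close>, out of reach of the open arc of \<open>T\<close>.\<close>
  have avoid: "z \<notin> U" if zC: "z \<in> C" and U: "frontier U = S" "\<And>x y. x \<in> U \<Longrightarrow> connected_component (- S) x y \<Longrightarrow> y \<in> U"
    and CS: "C \<inter> S = {}" and US: "U \<inter> (S \<union> T) = {}" and T: "closure C \<inter> (T - {a, b}) \<noteq> {}" "S \<inter> T = {a,b}" for z U S T
  proof
    assume "z \<in> U"
    have "C \<subseteq> U"
      using U(2)[OF \<open>z \<in> U\<close>] C(1) CS zC unfolding connected_component_def by blast
    then have "closure C \<subseteq> U \<union> S"
      using closure_mono[of C U] U(1) frontier_def[of U] interior_subset[of U] by blast
    then show False using T US by blast
  qed
  obtain z where z: "z \<in> C" using C by blast
  obtain U1 where U1: "connected U1" "U1 \<noteq> {}" "frontier U1 = path_image c \<union> path_image d"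
    "U1 \<inter> (path_image c \<union> path_image d \<union> path_image e) = {}"
    "\<And>z w. z \<in> U1 \<Longrightarrow> connected_component (- (path_image c \<union> path_image d)) z w \<Longrightarrow> w \<in> U1"
    using theta_graph_face[of c d e a b] assms by metis
  obtain U2 where U2: "frontier U2 = path_image c \<union> path_image e"
    "U2 \<inter> (path_image c \<union> path_image e \<union> path_image d) = {}"
    "\<And>z w. z \<in> U2 \<Longrightarrow> connected_component (- (path_image c \<union> path_image e)) z w \<Longrightarrow> w \<in> U2"
    "\<And>z w. z \<notin> path_image c \<union> path_image e \<Longrightarrow> z \<notin> U2 \<Longrightarrow> w \<in> path_image d - {a, b} \<Longrightarrow>
       connected_component (- (path_image c \<union> path_image e)) z w"
    using theta_graph_face[of c e d a b] assms by (metis Int_commute)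
  obtain U3 where U3: "frontier U3 = path_image d \<union> path_image e"
    "U3 \<inter> (path_image d \<union> path_image e \<union> path_image c) = {}"
    "\<And>z w. z \<in> U3 \<Longrightarrow> connected_component (- (path_image d \<union> path_image e)) z w \<Longrightarrow> w \<in> U3"
    "\<And>z w. z \<notin> path_image d \<union> path_image e \<Longrightarrow> z \<notin> U3 \<Longrightarrow> w \<in> path_image c - {a, b} \<Longrightarrow>
       connected_component (- (path_image d \<union> path_image e)) z w"
    using theta_graph_face[of d e c a b] assms by (metis Int_commute)
  have zU1: "z \<notin> U1"
    by (rule avoid[OF z U1(3) U1(5) _ U1(4) touch(3)]) (use C cd ce de in auto)
  have zU2: "z \<notin> U2"
    by (rule avoid[OF z U2(1) U2(3) _ U2(2) touch(2)]) (use C cd ce de in auto)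
  have zU3: "z \<notin> U3"
    by (rule avoid[OF z U3(1) U3(3) _ U3(2) touch(1)]) (use C cd ce de in auto)
  obtain o1 where o1: "o1 \<in> U1" using U1 by blast
  obtain p where p: "p \<in> path_image c - {a, b}" using touch by blast
  obtain q where q: "q \<in> path_image d - {a, b}" using touch by blast
  \<comment> \<open>Adding one frontier point \<open>r\<close> to \<open>U1\<close> leaves it
    connected, so \<open>insert r U1\<close> joins \<open>o1\<close> to \<open>r\<close> off
    \<open>S\<close>.\<close>
  have link: "connected_component (- S) o1 r" if r: "r \<in> path_image c \<union> path_image d" "r \<notin> S" "U1 \<inter> S = {}" for r S
  proof -
    have "r \<in> closure U1" using r U1(3) frontier_def[of U1] by blast
    then have "connected (insert r U1)"
      using connected_intermediate_closure[OF U1(1), of "insert r U1"] closure_subset[of U1] by blast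
    then show ?thesis unfolding connected_component_def using r o1 by blast
  qed
  \<comment> \<open>Neither \<open>c \<union> e\<close> nor \<open>d \<union> e\<close> separates \<open>o1\<close> from \<open>z\<close>, since \<open>U1\<close> touches both \<open>d\<close> and \<open>c\<close>.\<close>
  have "connected_component (- (path_image c \<union> path_image e)) o1 z"
  proof -
    have "connected_component (- (path_image c \<union> path_image e)) z q"
      by (rule U2(4)) (use z C zU2 q in blast)+
    moreover have "connected_component (- (path_image c \<union> path_image e)) o1 q"
      by (rule link) (use q cd de U1(4) in blast)+
    ultimately show ?thesis by (meson connected_component_sym connected_component_trans)
  qed
  moreover have "connected_component (- (path_image d \<union> path_image e)) o1 z"
  proof -
    have "connected_component (- (path_image d \<union> path_image e)) z p"
      by (rule U3(4)) (use z C zU3 p in blast)+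
    moreover have "connected_component (- (path_image d \<union> path_image e)) o1 p"
      by (rule link) (use p cd ce U1(4) in blast)+
    ultimately show ?thesis by (meson connected_component_sym connected_component_trans)
  qed
  moreover have "(path_image c \<union> path_image e) \<inter> (path_image d \<union> path_image e) = path_image e"
    using cd ce de by blast
  moreover have "connected (path_image e)" "compact (path_image c \<union> path_image e)"
      "closed (path_image d \<union> path_image e)"
    using \<open>arc c\<close> \<open>arc d\<close> \<open>arc e\<close>
    by (auto simp: arc_imp_path compact_Un compact_path_image compact_imp_closed connected_path_image closed_Un)
  ultimately have "connected_component (- ((path_image c \<union> path_image e) \<union> (path_image d \<union> path_image e))) o1 z"
    by (metis Janiszewski)
  then have "connected_component (- (path_image c \<union> path_image d)) o1 z"
    by (rule connected_component_of_subset) blast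
  then show False using U1(5) o1 zU1 by blast
qed

section \<open>Cutting and joining paths\<close>

text \<open>The preimage of \<open>S\<close> is compact, and \<open>g\<close> is cut at its least
  parameter \<open>t\<close>. The last property speaks of parameters because \<open>h\<close> need
  not be injective; for \<open>t = 0\<close> the path \<open>h\<close> is constant with value in
  \<open>S\<close>, hence the premise.\<close>

lemma path_first_hit:
  fixes g :: "real \<Rightarrow> 'a::real_normed_vector"
  assumes "path g" "closed S" "pathfinish g \<in> S"
  obtains h where "path h" "path_image h \<subseteq> path_image g" "pathstart h = pathstart g"
    "path_image h \<inter> S = {pathfinish h}" "pathstart g \<notin> S \<Longrightarrow> h ` {0..<1} \<inter> S = {}"
proof -
  define T where "T = {0..1} \<inter> g -` S"
  have cT: "closed T"
    unfolding T_def using assms continuous_closed_preimage[of "{0..1}" g S] by (auto simp: path_def)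
  have "compact T"
    using compact_Int_closed[OF _ cT, of "{0..1::real}"] by (simp add: T_def Int_assoc[symmetric])
  moreover have "1 \<in> T" using assms by (auto simp: T_def pathfinish_def)
  ultimately obtain t where t: "t \<in> T" "\<And>s. s \<in> T \<Longrightarrow> t \<le> s"
    using compact_attains_inf[of T] by blast
  have t01: "0 \<le> t" "t \<le> 1" using t(1) by (auto simp: T_def)
  have before: "g s \<notin> S" if "0 \<le> s" "s < t" for s using t(2)[of s] that t01 by (force simp: T_def)
  show ?thesis
  proof (rule that[of "subpath 0 t g"])
    show "path (subpath 0 t g)" using assms t01 by (simp add: path_subpath)
    show "path_image (subpath 0 t g) \<subseteq> path_image g" using t01 by (simp add: path_image_subpath_subset)
    show "pathstart (subpath 0 t g) = pathstart g" by (simp add: pathstart_def subpath_def)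
    show "path_image (subpath 0 t g) \<inter> S = {pathfinish (subpath 0 t g)}"
      using t t01 before by (auto simp: path_image_subpath T_def) (metis less_le)
    assume "pathstart g \<notin> S"
    then have "t > 0" using t(1) t01 by (cases "t = 0") (auto simp: T_def pathstart_def)
    then show "subpath 0 t g ` {0..<1} \<inter> S = {}"
      using before t01 by (auto simp: subpath_def)
  qed
qed

text \<open>Injectivity of \<open>P\<close> keeps the two pieces apart outside \<open>a\<close>.
  They are only paths, since one of them degenerates when \<open>a\<close> is an end of
  \<open>P\<close>.\<close>

lemma arc_split:
  fixes P :: "real \<Rightarrow> 'a::real_normed_vector"
  assumes "arc P" "a \<in> path_image P"
  obtains p q where "path p" "path q" "pathstart p = a" "pathstart q = a"
    "pathfinish p = pathstart P" "pathfinish q = pathfinish P"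
    "path_image p \<subseteq> path_image P" "path_image q \<subseteq> path_image P" "path_image p \<inter> path_image q \<subseteq> {a}"
proof -
  obtain t where t: "0 \<le> t" "t \<le> 1" "a = P t" using assms by (auto simp: path_image_def)
  have inj: "inj_on P {0..1}" "path P" using assms by (auto simp: arc_def)
  show ?thesis
  proof (rule that[of "subpath t 0 P" "subpath t 1 P"])
    show "path_image (subpath t 0 P) \<inter> path_image (subpath t 1 P) \<subseteq> {a}"
    proof
      fix x assume "x \<in> path_image (subpath t 0 P) \<inter> path_image (subpath t 1 P)"
      then obtain u v where uv: "0 \<le> u" "u \<le> t" "t \<le> v" "v \<le> 1" "x = P u" "x = P v"
        using t by (auto simp: path_image_subpath_gen closed_segment_eq_real_ivl split: if_splits)
      then have "u = v" using inj t by (auto simp: inj_on_def)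
      then show "x \<in> {a}" using uv t by auto
    qed
  qed (use t inj in \<open>auto simp: path_subpath path_image_subpath_subset pathstart_def[of P] pathfinish_def[of P]\<close>)
qed

text \<open>Join \<open>x 0\<close> and \<open>x 1\<close> by an arc \<open>P\<close> in
  \<open>R\<close> and follow a path from \<open>x 2\<close> until it first hits \<open>P\<close>;
  the hit point is the centre \<open>a\<close>. The points may coincide, with each other or with
  \<open>a\<close>, so the legs are paths and not arcs.\<close>

lemma path_connected_tripod:
  fixes R :: "'a::{complete_space,real_normed_vector} set" and x :: "nat \<Rightarrow> 'a"
  assumes R: "path_connected R" and x: "\<And>i. i < 3 \<Longrightarrow> x i \<in> R"
  obtains a q where "a \<in> R"
    "\<And>i. i < 3 \<Longrightarrow> path (q i) \<and> pathstart (q i) = a \<and> pathfinish (q i) = x i \<and> path_image (q i) \<subseteq> R"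
    "\<And>i j. i < 3 \<Longrightarrow> j < 3 \<Longrightarrow> i \<noteq> j \<Longrightarrow> path_image (q i) \<inter> path_image (q j) \<subseteq> {a}"
proof -
  note result = that
  obtain P where P: "path P" "pathstart P = x 0" "pathfinish P = x 1" "path_image P \<subseteq> R"
    and split: "\<And>a. a \<in> path_image P \<Longrightarrow> \<exists>p q. path p \<and> path q \<and> pathstart p = a \<and> pathstart q = a \<and>
      pathfinish p = x 0 \<and> pathfinish q = x 1 \<and> path_image p \<subseteq> R \<and> path_image q \<subseteq> R \<and>
      path_image p \<subseteq> path_image P \<and> path_image q \<subseteq> path_image P \<and>
      path_image p \<inter> path_image q \<subseteq> {a}"
  proof (cases "x 0 = x 1")
    case True
    show ?thesis
    proof (rule that[of "linepath (x 0) (x 0)"], goal_cases)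
      case (5 a)
      then show ?case using True x[of 0]
        by (intro exI[of _ "linepath (x 0) (x 0)"]) auto
    qed (use True x[of 0] in auto)
  next
    case False
    obtain p where "path p" "path_image p \<subseteq> R" "pathstart p = x 0" "pathfinish p = x 1"
      using R x[of 0] x[of 1] unfolding path_connected_def by force
    then obtain P where P: "arc P" "path_image P \<subseteq> R" "pathstart P = x 0" "pathfinish P = x 1"
      using path_contains_arc[of p "x 0" "x 1"] False by (metis subset_trans)
    show ?thesis
    proof (rule that[of P], goal_cases)
      case (5 a)
      obtain q r where qr: "path q" "path r" "pathstart q = a" "pathstart r = a"
        "pathfinish q = pathstart P" "pathfinish r = pathfinish P" "path_image q \<subseteq> path_image P"
        "path_image r \<subseteq> path_image P" "path_image q \<inter> path_image r \<subseteq> {a}"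
        by (rule arc_split[OF P(1) 5])
      then have "path_image q \<subseteq> R" "path_image r \<subseteq> R" using P(2) by simp_all
      then show ?case using qr P(3,4) by (intro exI[of _ q] exI[of _ r] conjI) simp_all
    qed (use P arc_imp_path in auto)
  qed
  have "x 2 \<in> R" "x 0 \<in> R" using x by auto
  then obtain Q where Q: "path Q" "path_image Q \<subseteq> R" "pathstart Q = x 2" "pathfinish Q = x 0"
    using R unfolding path_connected_def by blast
  obtain h where h: "path h" "path_image h \<subseteq> path_image Q" "pathstart h = x 2"
    "path_image h \<inter> path_image P = {pathfinish h}"
    using path_first_hit[of Q "path_image P"] Q P closed_path_image[of P] by (metis pathstart_in_path_image)
  define a where "a = pathfinish h"
  have "a \<in> path_image P" using h a_def by blast
  from split[OF this] obtain p q where pq: "path p" "path q" "pathstart p = a" "pathstart q = a"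
      "pathfinish p = x 0" "pathfinish q = x 1" "path_image p \<subseteq> R" "path_image q \<subseteq> R"
      "path_image p \<subseteq> path_image P" "path_image q \<subseteq> path_image P"
      "path_image p \<inter> path_image q \<subseteq> {a}" by blast
  define r where "r = (\<lambda>i::nat. if i = 0 then p else if i = 1 then q else reversepath h)"
  show ?thesis
  proof (rule result[of a r])
    show "a \<in> R" using \<open>a \<in> path_image P\<close> P by blast
    show "path (r i) \<and> pathstart (r i) = a \<and> pathfinish (r i) = x i \<and> path_image (r i) \<subseteq> R" if "i < 3" for i
    proof -
      have "i = 0 \<or> i = 1 \<or> i = 2" using that by auto
      then show ?thesis using pq h Q a_def by (auto simp: r_def)
    qed
    show "path_image (r i) \<inter> path_image (r j) \<subseteq> {a}" if "i < 3" "j < 3" "i \<noteq> j" for i j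
    proof -
      have "i = 0 \<or> i = 1 \<or> i = 2" "j = 0 \<or> j = 1 \<or> j = 2" using that by auto
      moreover have "path_image p \<inter> path_image h \<subseteq> {a}" "path_image q \<inter> path_image h \<subseteq> {a}"
        using pq(9,10) h(4) unfolding a_def by auto
      ultimately show ?thesis using pq(11) \<open>i \<noteq> j\<close> by (auto simp: r_def)
    qed
  qed
qed

text \<open>Shrinks a branch set \<open>R\<close> to a single point: the legs of a tripod inside
  \<open>R\<close> are prolonged by the \<open>g i\<close>, which touch \<open>R\<close> only at
  their starts, and each resulting path is thinned to an arc.\<close>

lemma tripod_extend_arcs:
  fixes R :: "'a::{complete_space,real_normed_vector} set" and g :: "nat \<Rightarrow> real \<Rightarrow> 'a"
  assumes R: "path_connected R" and g: "\<And>i. i < 3 \<Longrightarrow> arc (g i)"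
    and gR: "\<And>i. i < 3 \<Longrightarrow> path_image (g i) \<inter> R = {pathstart (g i)}"
    and gg: "\<And>i j. i < 3 \<Longrightarrow> j < 3 \<Longrightarrow> i \<noteq> j \<Longrightarrow> path_image (g i) \<inter> path_image (g j) \<subseteq> R"
  obtains a h where "a \<in> R"
    "\<And>i. i < 3 \<Longrightarrow> arc (h i) \<and> pathstart (h i) = a \<and> pathfinish (h i) = pathfinish (g i) \<and>
        path_image (h i) \<subseteq> R \<union> path_image (g i)"
    "\<And>i j. i < 3 \<Longrightarrow> j < 3 \<Longrightarrow> i \<noteq> j \<Longrightarrow> path_image (h i) \<inter> path_image (h j) = {a}"
proof -
  note result = that
  have "pathstart (g i) \<in> R" if "i < 3" for i using gR that by blast
  then obtain a q where a: "a \<in> R"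
    and q: "\<And>i. i < 3 \<Longrightarrow> path (q i) \<and> pathstart (q i) = a \<and> pathfinish (q i) = pathstart (g i) \<and> path_image (q i) \<subseteq> R"
    and qq: "\<And>i j. i < 3 \<Longrightarrow> j < 3 \<Longrightarrow> i \<noteq> j \<Longrightarrow> path_image (q i) \<inter> path_image (q j) \<subseteq> {a}"
    using path_connected_tripod[OF R, of "\<lambda>i. pathstart (g i)"] by metis
  have "\<exists>h. arc h \<and> pathstart h = a \<and> pathfinish h = pathfinish (g i) \<and>
          path_image h \<subseteq> path_image (q i) \<union> path_image (g i)" if i: "i < 3" for i
  proof -
    have "pathfinish (g i) \<notin> R"
      using gR[OF i] arc_distinct_ends[OF g[OF i]] pathfinish_in_path_image[of "g i"] by force
    then have "a \<noteq> pathfinish (g i)" using a by blast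
    moreover have "path (q i +++ g i)" "path_image (q i +++ g i) = path_image (q i) \<union> path_image (g i)"
      using q[OF i] g[OF i] by (auto simp: arc_imp_path path_image_join)
    ultimately show ?thesis
      using path_contains_arc[of "q i +++ g i" a "pathfinish (g i)"] q[OF i] by (metis pathfinish_join pathstart_join)
  qed
  then obtain h where h: "\<And>i. i < 3 \<Longrightarrow> arc (h i) \<and> pathstart (h i) = a \<and> pathfinish (h i) = pathfinish (g i) \<and>
        path_image (h i) \<subseteq> path_image (q i) \<union> path_image (g i)" by metis
  show ?thesis
  proof (rule result[of a h])
    show "a \<in> R" by fact
    show "arc (h i) \<and> pathstart (h i) = a \<and> pathfinish (h i) = pathfinish (g i) \<and>
        path_image (h i) \<subseteq> R \<union> path_image (g i)" if "i < 3" for i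
      using h[OF that] q[OF that] by blast
    show "path_image (h i) \<inter> path_image (h j) = {a}" if ij: "i < 3" "j < 3" "i \<noteq> j" for i j
    proof
      show "{a} \<subseteq> path_image (h i) \<inter> path_image (h j)"
        using h[OF ij(1)] h[OF ij(2)] pathstart_in_path_image by (metis IntI empty_subsetI insert_subset)
      \<comment> \<open>\<open>g l\<close> meets \<open>R\<close> only at its start, where the leg
        \<open>q l\<close> ends, so a point of \<open>q k\<close> on \<open>g l\<close> lies on two
        legs and must be \<open>a\<close>.\<close>
      have q_g: "path_image (q k) \<inter> path_image (g l) \<subseteq> {a}" if kl: "k < 3" "l < 3" "k \<noteq> l" for k l
      proof
        fix x assume x: "x \<in> path_image (q k) \<inter> path_image (g l)"
        then have "x = pathstart (g l)" using q[OF kl(1)] gR[OF kl(2)] by blast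
        then have "x \<in> path_image (q l)" using q[OF kl(2)] pathfinish_in_path_image[of "q l"] by simp
        then show "x \<in> {a}" using x qq[OF kl] by blast
      qed
      have g_g: "path_image (g i) \<inter> path_image (g j) \<subseteq> {a}"
      proof
        fix x assume x: "x \<in> path_image (g i) \<inter> path_image (g j)"
        then have "x = pathstart (g i)" using gg[OF ij] gR[OF ij(1)] by blast
        then have "x \<in> path_image (q i)" using q[OF ij(1)] pathfinish_in_path_image[of "q i"] by simp
        then show "x \<in> {a}" using x q_g[OF ij] by blast
      qed
      have "path_image (h i) \<inter> path_image (h j) \<subseteq>
          (path_image (q i) \<union> path_image (g i)) \<inter> (path_image (q j) \<union> path_image (g j))"
        using h[OF ij(1)] h[OF ij(2)] by (meson Int_mono)
      also have "\<dots> \<subseteq> {a}"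
        using g_g q_g[OF ij] q_g[OF ij(2,1)] qq[OF ij] ij(3) by auto
      finally show "path_image (h i) \<inter> path_image (h j) \<subseteq> {a}" .
    qed
  qed
qed

section \<open>\<open>K\<^sub>3\<^sub>,\<^sub>3\<close> with plane sets as vertices\<close>

text \<open>Sets in place of points let a minor be treated without contracting anything in the
  plane. Shrinking \<open>B 0\<close> and \<open>B 1\<close> to points \<open>a\<close> and
  \<open>b\<close> gives three arcs from \<open>a\<close> to \<open>b\<close>, one through each
  \<open>A i\<close>, which form a theta graph. \<open>B 2\<close> with its links to the
  \<open>A i\<close> yields a connected set off this graph whose closure meets all three open arcs,
  contrary to \<open>theta_graph_face_meets_two_arcs\<close>. In \<open>g j i\<close> the index of
  \<open>B\<close> comes first.\<close>

lemma no_K33_of_continua: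
  fixes A B :: "nat \<Rightarrow> complex set" and g :: "nat \<Rightarrow> nat \<Rightarrow> real \<Rightarrow> complex"
  assumes A: "\<And>i. i < 3 \<Longrightarrow> closed (A i) \<and> path_connected (A i)"
    and B: "\<And>i. i < 3 \<Longrightarrow> closed (B i) \<and> path_connected (B i)"
    and AA: "\<And>i j. i < 3 \<Longrightarrow> j < 3 \<Longrightarrow> i \<noteq> j \<Longrightarrow> A i \<inter> A j = {}"
    and BB: "\<And>i j. i < 3 \<Longrightarrow> j < 3 \<Longrightarrow> i \<noteq> j \<Longrightarrow> B i \<inter> B j = {}"
    and AB: "\<And>i j. i < 3 \<Longrightarrow> j < 3 \<Longrightarrow> A i \<inter> B j = {}"
    and g: "\<And>i j. i < 3 \<Longrightarrow> j < 3 \<Longrightarrow> arc (g j i)"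
    and gB: "\<And>i j. i < 3 \<Longrightarrow> j < 3 \<Longrightarrow> path_image (g j i) \<inter> B j = {pathstart (g j i)}"
    and gA: "\<And>i j. i < 3 \<Longrightarrow> j < 3 \<Longrightarrow> path_image (g j i) \<inter> A i = {pathfinish (g j i)}"
    and gB': "\<And>i j k. i < 3 \<Longrightarrow> j < 3 \<Longrightarrow> k < 3 \<Longrightarrow> k \<noteq> j \<Longrightarrow> path_image (g j i) \<inter> B k = {}"
    and gA': "\<And>i j k. i < 3 \<Longrightarrow> j < 3 \<Longrightarrow> k < 3 \<Longrightarrow> k \<noteq> i \<Longrightarrow> path_image (g j i) \<inter> A k = {}"
    and gg: "\<And>i j i' j'. i < 3 \<Longrightarrow> j < 3 \<Longrightarrow> i' < 3 \<Longrightarrow> j' < 3 \<Longrightarrow> (i, j) \<noteq> (i', j') \<Longrightarrow>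
        path_image (g j i) \<inter> path_image (g j' i') \<subseteq> (\<Union>k<3. A k \<union> B k)"
  shows False
proof -
  have ggB: "path_image (g j i) \<inter> path_image (g j i') \<subseteq> B j" if ii: "i < 3" "j < 3" "i' < 3" "i \<noteq> i'" for i i' j
  proof
    fix x assume x: "x \<in> path_image (g j i) \<inter> path_image (g j i')"
    then obtain k where k: "k < 3" "x \<in> A k \<or> x \<in> B k" using gg[of i j i' j] ii by auto
    then have "x \<notin> A k" using x gA'[of i j k] gA'[of i' j k] ii by (cases "k = i") auto
    then show "x \<in> B j" using x k gB'[of i j k] ii by (cases "k = j") auto
  qed
  have gg0: "path_image (g j i) \<inter> path_image (g j' i') = {}"
    if ii: "i < 3" "j < 3" "i' < 3" "j' < 3" "i \<noteq> i'" "j \<noteq> j'" for i i' j j'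
  proof (rule ccontr)
    assume "\<not> ?thesis"
    then obtain x where x: "x \<in> path_image (g j i)" "x \<in> path_image (g j' i')" by blast
    then obtain k where k: "k < 3" "x \<in> A k \<or> x \<in> B k" using gg[of i j i' j'] ii by auto
    have "x \<notin> A k" using x k gA'[of i j k] gA'[of i' j' k] ii by (cases "k = i") auto
    moreover have "x \<notin> B k" using x k gB'[of i j k] gB'[of i' j' k] ii by (cases "k = j") auto
    ultimately show False using k by blast
  qed
  have tripod: "\<exists>a h. a \<in> B j \<and> (\<forall>i<3. arc (h i) \<and> pathstart (h i) = a \<and> pathfinish (h i) = pathfinish (g j i) \<and>
           path_image (h i) \<subseteq> B j \<union> path_image (g j i)) \<and>
         (\<forall>i<3. \<forall>i'<3. i \<noteq> i' \<longrightarrow> path_image (h i) \<inter> path_image (h i') = {a})" if "j < 3" for j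
    apply (rule tripod_extend_arcs[of "B j" "g j"])
    subgoal using B[OF that] by blast
    subgoal using g that by blast
    subgoal using gB that by blast
    subgoal using ggB that by blast
    subgoal for a h by blast
    done
  obtain a h where a: "a \<in> B 0" and h: "\<forall>i<3. arc (h i) \<and> pathstart (h i) = a \<and>
       pathfinish (h i) = pathfinish (g 0 i) \<and> path_image (h i) \<subseteq> B 0 \<union> path_image (g 0 i)"
    and hh: "\<forall>i<3. \<forall>i'<3. i \<noteq> i' \<longrightarrow> path_image (h i) \<inter> path_image (h i') = {a}"
    using tripod[OF zero_less_numeral] by (elim exE conjE)
  have "(1::nat) < 3" by simp
  from tripod[OF this] obtain b h' where b: "b \<in> B 1" and h': "\<forall>i<3. arc (h' i) \<and> pathstart (h' i) = b \<and>
       pathfinish (h' i) = pathfinish (g 1 i) \<and> path_image (h' i) \<subseteq> B 1 \<union> path_image (g 1 i)"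
    and hh': "\<forall>i<3. \<forall>i'<3. i \<noteq> i' \<longrightarrow> path_image (h' i) \<inter> path_image (h' i') = {b}"
    by (elim exE conjE)
  note h = h[rule_format] and h' = h'[rule_format] and hh = hh[rule_format] and hh' = hh'[rule_format]
  have h_sub: "path_image (h i) \<subseteq> B 0 \<union> path_image (g 0 i)" "path_image (h' i) \<subseteq> B 1 \<union> path_image (g 1 i)"
    if "i < 3" for i using h[OF that] h'[OF that] by blast+
  have ab: "a \<noteq> b" using a b BB[of 0 1] by auto
  have fin: "pathfinish (g j i) \<in> A i" if "i < 3" "j < 3" for i j using gA that by blast
  have pathA: "\<exists>p. path p \<and> path_image p \<subseteq> A i \<and> pathstart p = x \<and> pathfinish p = y"
    if "i < 3" "x \<in> A i" "y \<in> A i" for i x y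
    using A[OF that(1)] that(2,3) unfolding path_connected_def by blast
  \<comment> \<open>Two legs are joined by a path \<open>m\<close> through \<open>A i\<close>; the
    result may cross itself, so an arc is extracted from it.\<close>
  have "\<exists>c. arc c \<and> pathstart c = a \<and> pathfinish c = b \<and>
          path_image c \<subseteq> path_image (h i) \<union> A i \<union> path_image (h' i)" if i: "i < 3" for i
  proof -
    obtain m where m: "path m" "path_image m \<subseteq> A i" "pathstart m = pathfinish (g 0 i)" "pathfinish m = pathfinish (g 1 i)"
      using pathA[OF i fin[OF i, of 0] fin[OF i, of 1]] by auto
    define w where "w = h i +++ m +++ reversepath (h' i)"
    have "path w" "pathstart w = a" "pathfinish w = b"
      "path_image w \<subseteq> path_image (h i) \<union> A i \<union> path_image (h' i)"
      using m h[OF i] h'[OF i] unfolding w_def by (auto simp: arc_imp_path path_image_join)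
    then show ?thesis using path_contains_arc[of w a b] ab by (metis subset_trans)
  qed
  then obtain c where c: "\<And>i. i < 3 \<Longrightarrow> arc (c i) \<and> pathstart (c i) = a \<and> pathfinish (c i) = b \<and>
          path_image (c i) \<subseteq> path_image (h i) \<union> A i \<union> path_image (h' i)" by metis
  have c_sub: "path_image (c i) \<subseteq> path_image (h i) \<union> A i \<union> path_image (h' i)" if "i < 3" for i
    using c[OF that] by blast
  have ends: "a \<in> path_image (c i)" "b \<in> path_image (c i)" if "i < 3" for i
    using c[OF that] pathstart_in_path_image[of "c i"] pathfinish_in_path_image[of "c i"] by auto
  have cc: "path_image (c i) \<inter> path_image (c j) = {a, b}" if ij: "i < 3" "j < 3" "i \<noteq> j" for i j
  proof
    show "{a, b} \<subseteq> path_image (c i) \<inter> path_image (c j)" using ends ij by auto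
    have 1: "path_image (h i) \<inter> A j = {}" if "i < 3" "j < 3" "i \<noteq> j" for i j
      using h_sub(1)[OF that(1)] AB[OF that(2), of 0] gA'[OF that(1) _ that(2), of 0] that by auto
    have 2: "path_image (h' i) \<inter> A j = {}" if "i < 3" "j < 3" "i \<noteq> j" for i j
      using h_sub(2)[OF that(1)] AB[OF that(2), of 1] gA'[OF that(1) _ that(2), of 1] that by auto
    have 3: "path_image (h i) \<inter> path_image (h' j) = {}" if "i < 3" "j < 3" "i \<noteq> j" for i j
      using h_sub(1)[OF that(1)] h_sub(2)[OF that(2)] BB[of 0 1] gg0[of i 0 j 1] gB'[of i 0 1] gB'[of j 1 0] that by simp blast
    have "path_image (c i) \<inter> path_image (c j) \<subseteq>
        (path_image (h i) \<union> A i \<union> path_image (h' i)) \<inter> (path_image (h j) \<union> A j \<union> path_image (h' j))"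
      by (rule Int_mono[OF c_sub[OF ij(1)] c_sub[OF ij(2)]])
    also have "\<dots> \<subseteq> {a, b}"
      using AA[OF ij] hh[OF ij] hh'[OF ij] 1[OF ij] 1[OF ij(2,1)] 2[OF ij] 2[OF ij(2,1)]
        3[OF ij] 3[OF ij(2,1)] ij(3) by (simp add: Int_Un_distrib Int_Un_distrib2 Int_commute)
    finally show "path_image (c i) \<inter> path_image (c j) \<subseteq> {a, b}" .
  qed
  \<comment> \<open>Otherwise \<open>c i\<close> would be covered by two closed sets that are
    disjoint on it, one containing \<open>a\<close> and the other \<open>b\<close>.\<close>
  have cA: "path_image (c i) \<inter> A i \<noteq> {}" if i: "i < 3" for i
  proof
    assume empty: "path_image (c i) \<inter> A i = {}"
    have "connected (path_image (c i))" using c[OF i] arc_imp_path connected_path_image by blast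
    moreover have "closed (B 0 \<union> path_image (g 0 i))" "closed (B 1 \<union> path_image (g 1 i))"
      using B[of 0] B[of 1] g[of i 0] g[of i 1] i by (auto simp: arc_imp_path closed_path_image closed_Un)
    moreover have "path_image (c i) \<subseteq> (B 0 \<union> path_image (g 0 i)) \<union> (B 1 \<union> path_image (g 1 i))"
      using c_sub[OF i] h_sub[OF i] empty by blast
    moreover have "(B 0 \<union> path_image (g 0 i)) \<inter> (B 1 \<union> path_image (g 1 i)) \<inter> path_image (c i) = {}"
    proof -
      have "path_image (g 0 i) \<inter> path_image (g 1 i) \<subseteq> A i"
      proof
        fix x assume x: "x \<in> path_image (g 0 i) \<inter> path_image (g 1 i)"
        then obtain k where k: "k < 3" "x \<in> A k \<or> x \<in> B k" using gg[of i 0 i 1] i by auto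
        have "x \<notin> B k" using x k gB'[of i 0 k] gB'[of i 1 k] i by (cases "k = 0") auto
        then show "x \<in> A i" using x k gA'[of i 0 k] i by (cases "k = i") auto
      qed
      then show ?thesis using empty BB[of 0 1] gB'[of i 0 1] gB'[of i 1 0] i by auto
    qed
    ultimately have "(B 0 \<union> path_image (g 0 i)) \<inter> path_image (c i) = {} \<or> (B 1 \<union> path_image (g 1 i)) \<inter> path_image (c i) = {}"
      using connected_closed[of "path_image (c i)"] by blast
    then show False using a b ends[OF i] by blast
  qed
  \<comment> \<open>\<open>M i\<close> is \<open>B 2\<close> with its link to \<open>A i\<close> and
    \<open>A i\<close> itself; the only arc of the theta graph that it can meet is
    \<open>c i\<close>, and that away from \<open>a\<close> and \<open>b\<close>.\<close>
  define M where "M i = B 2 \<union> path_image (g 2 i) \<union> A i" for i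
  have Mc: "M i \<inter> path_image (c j) = {}" if ij: "i < 3" "j < 3" "i \<noteq> j" for i j
  proof -
    have "path_image (c j) \<subseteq> B 0 \<union> path_image (g 0 j) \<union> A j \<union> path_image (g 1 j) \<union> B 1"
      using c_sub[OF ij(2)] h_sub[OF ij(2)] by blast
    moreover have "M i \<inter> (B 0 \<union> path_image (g 0 j) \<union> A j \<union> path_image (g 1 j) \<union> B 1) = {}"
      using ij AA[OF ij] AB[OF ij(1), of 0] AB[OF ij(1), of 1] AB[OF ij(2), of 2] BB[of 0 2] BB[of 1 2]
        gg0[of i 2 j 0] gg0[of i 2 j 1] gB'[of i 2 0] gB'[of i 2 1] gB'[of j 0 2] gB'[of j 1 2]
        gA'[of i 2 j] gA'[of j 0 i] gA'[of j 1 i]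
      unfolding M_def by auto
    ultimately show ?thesis by blast
  qed
  have Mab: "a \<notin> M i" "b \<notin> M i" if i: "i < 3" for i
    using a b i AB[of i 0] AB[of i 1] BB[of 0 2] BB[of 1 2] gB'[of i 2 0] gB'[of i 2 1] unfolding M_def by auto
  have B2c: "B 2 \<inter> path_image (c i) = {}" if "i < 3" for i
    using Mc[of 1 i] Mc[of 0 i] that unfolding M_def by (cases "i = 0") auto
  define y where "y = pathstart (g 2 0)"
  have y: "y \<in> B 2" unfolding y_def using gB[of 0 2] by auto
  \<comment> \<open>A path in \<open>M i\<close> from the common base point \<open>y\<close> to
    \<open>c i\<close> is stopped just before its first hit. The hit point is in the closure of the
    half-open image \<open>D\<close>, and as a point of \<open>M i\<close> it differs from
    \<open>a\<close> and \<open>b\<close>.\<close>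
  have "\<exists>D. connected D \<and> y \<in> D \<and> D \<subseteq> M i \<and> D \<inter> path_image (c i) = {} \<and>
          closure D \<inter> (path_image (c i) - {a, b}) \<noteq> {}" if i: "i < 3" for i
  proof -
    obtain x where x: "x \<in> path_image (c i)" "x \<in> A i" using cA[OF i] by blast
    have s: "pathstart (g 2 i) \<in> B 2" using gB[OF i, of 2] by auto
    obtain p where p: "path p" "path_image p \<subseteq> B 2" "pathstart p = y" "pathfinish p = pathstart (g 2 i)"
      using B[of 2] y s unfolding path_connected_def by (metis less_add_one numeral_2_eq_2 numeral_3_eq_3 lessI)
    obtain q where q: "path q" "path_image q \<subseteq> A i" "pathstart q = pathfinish (g 2 i)" "pathfinish q = x"
      using pathA[OF i fin[OF i, of 2] x(2)] by auto
    define w where "w = p +++ g 2 i +++ q"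
    have w: "path w" "pathstart w = y" "pathfinish w = x" "path_image w \<subseteq> M i"
      using p q g[of i 2] i unfolding w_def M_def by (auto simp: arc_imp_path path_image_join)
    have cl: "closed (path_image (c i))" using c[OF i] by (simp add: arc_imp_path closed_path_image)
    obtain f where f: "path f" "path_image f \<subseteq> path_image w" "pathstart f = y"
      "path_image f \<inter> path_image (c i) = {pathfinish f}" "f ` {0..<1} \<inter> path_image (c i) = {}"
      using path_first_hit[OF w(1) cl] w x y B2c[OF i] by (metis disjoint_iff)
    have cf: "continuous_on {0..1} f" using f(1) path_def by blast
    show ?thesis
    proof (intro exI[of _ "f ` {0..<1}"] conjI)
      have "continuous_on {0..<1} f" using cf by (rule continuous_on_subset) auto
      then show "connected (f ` {0..<1})" by (intro connected_continuous_image) auto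
      show "y \<in> f ` {0..<1}" using f(3) by (auto simp: pathstart_def)
      show "f ` {0..<1} \<subseteq> M i" using f(2) w(4) by (force simp: path_image_def)
      have "f ` {0..1} \<subseteq> closure (f ` {0..<1})"
        using image_closure_subset[of "{0..<1::real}" f "closure (f ` {0..<1})"] cf closure_subset[of "f ` {0..<1}"] by simp
      then have "pathfinish f \<in> closure (f ` {0..<1})" by (auto simp: pathfinish_def)
      moreover have "pathfinish f \<in> path_image (c i)" "pathfinish f \<in> M i"
        using f w(4) pathfinish_in_path_image[of f] by blast+
      ultimately show "closure (f ` {0..<1}) \<inter> (path_image (c i) - {a, b}) \<noteq> {}"
        using Mab[OF i] by blast
    qed (use f in auto)
  qed
  then obtain D where D: "\<And>i. i < 3 \<Longrightarrow> connected (D i) \<and> y \<in> D i \<and> D i \<subseteq> M i \<and> D i \<inter> path_image (c i) = {} \<and>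
          closure (D i) \<inter> (path_image (c i) - {a, b}) \<noteq> {}" by metis
  define C where "C = (\<Union>i<3. D i)"
  have DC: "D i \<subseteq> C" if "i < 3" for i using that unfolding C_def by auto
  show False
  proof (rule theta_graph_face_meets_two_arcs[of "c 0" "c 1" "c 2" a b C])
    have "y \<in> \<Inter> (D ` {..<3})" using D by auto
    then have ne: "\<Inter> (D ` {..<3}) \<noteq> {}" by blast
    show "connected C" unfolding C_def by (rule connected_Union[OF _ ne]) (use D in auto)
    show "C \<noteq> {}" using DC[of 0] D[of 0] by auto
    have Dc: "x \<notin> path_image (c j)" if "i < 3" "j < 3" "x \<in> D i" for i j x
      using D[OF that(1)] Mc[OF that(1,2)] that(3) by (cases "i = j") auto
    show "C \<inter> (path_image (c 0) \<union> path_image (c 1) \<union> path_image (c 2)) = {}"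
      using Dc[of _ 0] Dc[of _ 1] Dc[of _ 2] unfolding C_def by auto
    show "closure C \<inter> (path_image (c 0) - {a, b}) \<noteq> {}"
      using D[of 0] closure_mono[OF DC[of 0]] by auto
    show "closure C \<inter> (path_image (c 1) - {a, b}) \<noteq> {}"
      using D[of 1] closure_mono[OF DC[of 1]] by auto
    show "closure C \<inter> (path_image (c 2) - {a, b}) \<noteq> {}"
      using D[of 2] closure_mono[OF DC[of 2]] by auto
  qed (use c cc in auto)
qed

section \<open>\<open>K\<^sub>3\<^sub>,\<^sub>3\<close> minors\<close>

text \<open>Connectedness is phrased by cuts, which makes it immediate for unions and contractions.\<close>

definition connected_in :: "'a set set \<Rightarrow> 'a set \<Rightarrow> bool" where
  "connected_in E S \<longleftrightarrow> S \<noteq> {} \<and>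
     (\<forall>T\<subseteq>S. T \<noteq> {} \<longrightarrow> (\<forall>u\<in>T. \<forall>v\<in>S. {u, v} \<in> E \<longrightarrow> v \<in> T) \<longrightarrow> T = S)"

text \<open>\<open>A\<close> and \<open>B\<close> are the branch sets of a minor model, which spares
  sequences of deletions and contractions.\<close>

definition K33_minor :: "'a set \<Rightarrow> 'a set set \<Rightarrow> bool" where
  "K33_minor V E \<longleftrightarrow> (\<exists>A B :: nat \<Rightarrow> 'a set.
     (\<forall>i<3. A i \<subseteq> V \<and> B i \<subseteq> V \<and> connected_in E (A i) \<and> connected_in E (B i)) \<and>
     (\<forall>i<3. \<forall>j<3. i \<noteq> j \<longrightarrow> A i \<inter> A j = {} \<and> B i \<inter> B j = {}) \<and>
     (\<forall>i<3. \<forall>j<3. A i \<inter> B j = {} \<and> (\<exists>u\<in>A i. \<exists>v\<in>B j. {u, v} \<in> E)))"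

lemma connected_in_singleton: "connected_in E {x}"
  by (auto simp: connected_in_def)

lemma connected_in_star:
  assumes "\<And>v. v \<in> S \<Longrightarrow> {x, v} \<in> E"
  shows "connected_in E (insert x S)"
  unfolding connected_in_def
proof (intro conjI allI impI)
  fix T assume T: "T \<subseteq> insert x S" "T \<noteq> {}" "\<forall>u\<in>T. \<forall>v\<in>insert x S. {u, v} \<in> E \<longrightarrow> v \<in> T"
  have "x \<in> T"
  proof (rule ccontr)
    assume "x \<notin> T"
    then obtain v where "v \<in> T" "v \<in> S" using T by auto
    then show False using T(3) assms[of v] \<open>x \<notin> T\<close> by (auto simp: insert_commute)
  qed
  then show "T = insert x S" using T assms by blast
qed auto

text \<open>\<open>E'\<close> acts as a quotient graph whose vertices stand for the sets
  \<open>F x\<close>. A closed part \<open>T\<close> of the union contains every \<open>F x\<close>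
  that it meets, so the indices met form a nonempty closed part of \<open>A\<close>, which is all of
  \<open>A\<close>.\<close>

lemma connected_in_UN:
  assumes A: "connected_in E' A" and F: "\<And>x. x \<in> A \<Longrightarrow> connected_in E (F x)"
    and E': "\<And>x y. x \<in> A \<Longrightarrow> y \<in> A \<Longrightarrow> {x, y} \<in> E' \<Longrightarrow> \<exists>u\<in>F x. \<exists>v\<in>F y. {u, v} \<in> E"
  shows "connected_in E (\<Union>x\<in>A. F x)"
  unfolding connected_in_def
proof (intro conjI allI impI)
  show "(\<Union>x\<in>A. F x) \<noteq> {}" using A F by (force simp: connected_in_def)
  fix T assume T: "T \<subseteq> (\<Union>x\<in>A. F x)" "T \<noteq> {}" "\<forall>u\<in>T. \<forall>v\<in>(\<Union>x\<in>A. F x). {u, v} \<in> E \<longrightarrow> v \<in> T"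
  define X where "X = {x \<in> A. F x \<inter> T \<noteq> {}}"
  have FT: "F x \<subseteq> T" if "x \<in> X" for x
  proof -
    have x: "x \<in> A" "F x \<inter> T \<noteq> {}" using that by (auto simp: X_def)
    have "\<forall>u\<in>F x \<inter> T. \<forall>v\<in>F x. {u, v} \<in> E \<longrightarrow> v \<in> F x \<inter> T" using T(3) x(1) by blast
    then have "F x \<inter> T = F x" using F[OF x(1)] x(2) unfolding connected_in_def by (meson inf_le1)
    then show ?thesis by blast
  qed
  have "X = A"
  proof -
    have "X \<noteq> {}" using T(1,2) by (fastforce simp: X_def)
    moreover have "X \<subseteq> A" by (auto simp: X_def)
    moreover have "y \<in> X" if xy: "x \<in> X" "y \<in> A" "{x, y} \<in> E'" for x y
    proof -
      obtain u v where "u \<in> F x" "v \<in> F y" "{u, v} \<in> E"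
        using E'[of x y] xy unfolding X_def by auto
      then have "v \<in> T" using FT[OF xy(1)] T(3) xy(2) by blast
      then show ?thesis using xy \<open>v \<in> F y\<close> by (auto simp: X_def)
    qed
    ultimately show ?thesis using A unfolding connected_in_def by blast
  qed
  then show "T = (\<Union>x\<in>A. F x)" using FT T(1) by blast
qed

text \<open>\<open>F\<close> is a model of one graph in another; composing it with the branch sets
  gives branch sets in the other.\<close>

lemma K33_minor_trans:
  assumes K: "K33_minor V' E'"
    and F: "\<And>x. x \<in> V' \<Longrightarrow> F x \<subseteq> V \<and> connected_in E (F x)"
    and disj: "\<And>x y. x \<in> V' \<Longrightarrow> y \<in> V' \<Longrightarrow> x \<noteq> y \<Longrightarrow> F x \<inter> F y = {}"
    and E': "\<And>x y. x \<in> V' \<Longrightarrow> y \<in> V' \<Longrightarrow> {x, y} \<in> E' \<Longrightarrow> \<exists>u\<in>F x. \<exists>v\<in>F y. {u, v} \<in> E"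
  shows "K33_minor V E"
proof -
  obtain A B :: "nat \<Rightarrow> 'a set" where
    AB: "\<forall>i<3. A i \<subseteq> V' \<and> B i \<subseteq> V' \<and> connected_in E' (A i) \<and> connected_in E' (B i)"
    and AB_disj: "\<forall>i<3. \<forall>j<3. i \<noteq> j \<longrightarrow> A i \<inter> A j = {} \<and> B i \<inter> B j = {}"
    and AB_edge: "\<forall>i<3. \<forall>j<3. A i \<inter> B j = {} \<and> (\<exists>u\<in>A i. \<exists>v\<in>B j. {u, v} \<in> E')"
    using K unfolding K33_minor_def by (elim exE conjE)
  define U where "U X = (\<Union>x\<in>X. F x)" for X
  have conn: "U X \<subseteq> V \<and> connected_in E (U X)" if "X \<subseteq> V'" "connected_in E' X" for X
    unfolding U_def using connected_in_UN[of E' X E F] that F E' by blast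
  have U_disj: "U X \<inter> U Y = {}" if "X \<subseteq> V'" "Y \<subseteq> V'" "X \<inter> Y = {}" for X Y
    unfolding U_def using that disj by blast
  have edge: "\<exists>u\<in>U X. \<exists>v\<in>U Y. {u, v} \<in> E" if XY: "X \<subseteq> V'" "Y \<subseteq> V'" "\<exists>u\<in>X. \<exists>v\<in>Y. {u, v} \<in> E'" for X Y
  proof -
    obtain x y where xy: "x \<in> X" "y \<in> Y" "{x, y} \<in> E'" using XY(3) by blast
    then have "\<exists>u\<in>F x. \<exists>v\<in>F y. {u, v} \<in> E" using XY(1,2) by (intro E') auto
    then show ?thesis using xy(1,2) unfolding U_def by blast
  qed
  have sub: "A i \<subseteq> V'" "B i \<subseteq> V'" "connected_in E' (A i)" "connected_in E' (B i)" if "i < 3" for i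
    using AB that by auto
  have "\<forall>i<3. U (A i) \<subseteq> V \<and> U (B i) \<subseteq> V \<and> connected_in E (U (A i)) \<and> connected_in E (U (B i))"
    using conn[OF sub(1,3)] conn[OF sub(2,4)] by simp
  moreover have "\<forall>i<3. \<forall>j<3. i \<noteq> j \<longrightarrow> U (A i) \<inter> U (A j) = {} \<and> U (B i) \<inter> U (B j) = {}"
    using U_disj[OF sub(1) sub(1)] U_disj[OF sub(2) sub(2)] AB_disj by simp
  moreover have "\<forall>i<3. \<forall>j<3. U (A i) \<inter> U (B j) = {} \<and> (\<exists>u\<in>U (A i). \<exists>v\<in>U (B j). {u, v} \<in> E)"
    using U_disj[OF sub(1) sub(2)] edge[OF sub(1) sub(2)] AB_edge by simp
  ultimately show ?thesis unfolding K33_minor_def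
    by (intro exI[of _ "\<lambda>i. U (A i)"] exI[of _ "\<lambda>i. U (B i)"] conjI)
qed

lemma K33_minor_mono:
  assumes "K33_minor V' E'" "V' \<subseteq> V" "E' \<subseteq> E"
  shows "K33_minor V E"
  by (rule K33_minor_trans[OF assms(1), of "\<lambda>x. {x}"]) (use assms(2,3) in \<open>auto simp: connected_in_singleton\<close>)

text \<open>\<open>x\<close>, \<open>y\<close>, \<open>z\<close> form one side and \<open>C\<close>,
  \<open>p\<close>, \<open>q\<close> the other. It serves both for the neighbourhood of a vertex of
  degree 5, where \<open>C\<close> is a single vertex, and for a component attached to a
  \<open>K\<^sub>5\<close>.\<close>

lemma K33_minor_five_vertices_and_connected_set:
  assumes dist: "distinct [x, y, z, p, q]" and V: "{x, y, z, p, q} \<subseteq> V" "C \<subseteq> V"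
    and C: "connected_in E C" "C \<inter> {x, y, z, p, q} = {}"
    and adj: "\<And>w. w \<in> {x, y, z} \<Longrightarrow> {w, p} \<in> E \<and> {w, q} \<in> E \<and> (\<exists>u\<in>C. {w, u} \<in> E)"
  shows "K33_minor V E"
proof -
  have all3: "(\<forall>i<(3::nat). P i) \<longleftrightarrow> P 0 \<and> P 1 \<and> P 2" for P
    by (auto simp: numeral_3_eq_3 less_Suc_eq numeral_2_eq_2)
  define A where "A = (\<lambda>i::nat. if i = 0 then {x} else if i = 1 then {y} else {z})"
  define B where "B = (\<lambda>i::nat. if i = 0 then C else if i = 1 then {p} else {q})"
  have "\<forall>i<3. A i \<subseteq> V \<and> B i \<subseteq> V \<and> connected_in E (A i) \<and> connected_in E (B i)"
    using V C unfolding all3 A_def B_def by (auto simp: connected_in_singleton)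
  moreover have "\<forall>i<3. \<forall>j<3. i \<noteq> j \<longrightarrow> A i \<inter> A j = {} \<and> B i \<inter> B j = {}"
    using dist C unfolding all3 A_def B_def by auto
  moreover have "\<forall>i<3. \<forall>j<3. A i \<inter> B j = {} \<and> (\<exists>u\<in>A i. \<exists>v\<in>B j. {u, v} \<in> E)"
    using dist C adj unfolding all3 A_def B_def by simp
  ultimately show ?thesis unfolding K33_minor_def by blast
qed

section \<open>Simple graphs, degrees and incidences\<close>

lemma simple_graph_edge:
  assumes "simple_graph V E" "e \<in> E" "v \<in> e"
  obtains u where "e = {u, v}" "u \<noteq> v" "u \<in> V" "v \<in> V"
proof -
  have "card e = 2" "e \<subseteq> V" using assms by (auto simp: simple_graph_def)
  then obtain a b where "e = {a, b}" "a \<noteq> b" by (meson card_2_iff)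
  then show ?thesis using that[of a] that[of b] assms \<open>e \<subseteq> V\<close> by auto
qed

lemma simple_graph_adj:
  assumes "simple_graph V E" "{u, v} \<in> E"
  shows "u \<noteq> v" "u \<in> V" "v \<in> V"
proof -
  have "card {u, v} = 2" "{u, v} \<subseteq> V" using assms unfolding simple_graph_def by blast+
  then show "u \<noteq> v" "u \<in> V" "v \<in> V" by auto
qed

lemma mem_neighbors:
  assumes "simple_graph V E"
  shows "u \<in> neighbors E v \<longleftrightarrow> {u, v} \<in> E"
  using simple_graph_adj[OF assms] by (auto simp: neighbors_def)

lemma neighbors_sym: "u \<in> neighbors E v \<longleftrightarrow> v \<in> neighbors E u"
  by (auto simp: neighbors_def insert_commute)

lemma neighbors_subset: "simple_graph V E \<Longrightarrow> neighbors E v \<subseteq> V"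
  by (auto simp: neighbors_def dest: simple_graph_adj(2))

lemma finite_neighbors: "simple_graph V E \<Longrightarrow> finite (neighbors E v)"
  by (meson finite_subset neighbors_subset simple_graph_def)

lemma simple_graph_finite_edges: "simple_graph V E \<Longrightarrow> finite E"
  by (rule finite_subset[of _ "Pow V"]) (auto simp: simple_graph_def)

lemma simple_graph_subset: "simple_graph V E \<Longrightarrow> E' \<subseteq> E \<Longrightarrow> simple_graph V E'"
  by (auto simp: simple_graph_def)

lemma incident_edges:
  assumes "simple_graph V E"
  shows "{e \<in> E. v \<in> e} = (\<lambda>u. {u, v}) ` neighbors E v"
proof
  show "{e \<in> E. v \<in> e} \<subseteq> (\<lambda>u. {u, v}) ` neighbors E v"
    using simple_graph_edge[OF assms] mem_neighbors[OF assms] by blast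
qed (auto simp: neighbors_def)

lemma inj_on_edge: "inj_on (\<lambda>u. {u, v}) A"
  by (auto simp: inj_on_def doubleton_eq_iff)

lemma card_incident_edges:
  assumes "simple_graph V E"
  shows "card {e \<in> E. v \<in> e} = vertex_degree E v"
  unfolding incident_edges[OF assms] vertex_degree_def by (rule card_image[OF inj_on_edge])

lemma sum_vertex_degree:
  assumes "simple_graph V E"
  shows "(\<Sum>v\<in>V. vertex_degree E v) = 2 * card E"
proof -
  have fin: "finite V" "finite E" using assms simple_graph_finite_edges by (auto simp: simple_graph_def)
  have "(\<Sum>v\<in>V. vertex_degree E v) = (\<Sum>v\<in>V. card {e \<in> E. v \<in> e})"
    using card_incident_edges[OF assms] by simp
  also have "\<dots> = (\<Sum>v\<in>V. \<Sum>e\<in>E. if v \<in> e then 1 else 0)"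
    using fin by (simp add: sum.If_cases Int_def)
  also have "\<dots> = (\<Sum>e\<in>E. \<Sum>v\<in>V. if v \<in> e then 1 else 0)"
    by (rule sum.swap)
  also have "\<dots> = (\<Sum>e\<in>E. 2)"
  proof (rule sum.cong)
    fix e assume "e \<in> E"
    then have "card e = 2" "V \<inter> e = e" using assms by (auto simp: simple_graph_def)
    then show "(\<Sum>v\<in>V. if v \<in> e then 1 else 0) = (2::nat)" using fin by (simp add: sum.If_cases)
  qed simp
  finally show ?thesis by simp
qed

section \<open>Edge bound for graphs without \<open>K\<^sub>3\<^sub>,\<^sub>3\<close> minor\<close>

text \<open>\<open>y\<close> is merged into \<open>x\<close>: the edge \<open>{x, y}\<close> is
  lost, and for every common neighbour two edges become one.\<close>

lemma contract_edge:
  assumes G: "simple_graph V E" and xy: "{x, y} \<in> E"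
  obtains E' where "simple_graph (V - {y}) E'"
    "card E' + card (neighbors E x \<inter> neighbors E y) + 1 = card E"
    "K33_minor (V - {y}) E' \<Longrightarrow> K33_minor V E"
proof -
  note adj = simple_graph_adj[OF G]
  note nb = mem_neighbors[OF G]
  have x_y: "x \<noteq> y" "x \<in> V" "y \<in> V" using adj[OF xy] by auto
  have finE: "finite E" by (rule simple_graph_finite_edges[OF G])
  define E0 where "E0 = {e \<in> E. y \<notin> e}"
  \<comment> \<open>\<open>W\<close> holds the neighbours of \<open>y\<close> that are new to
    \<open>x\<close>; with the common ones left out, the added edges are not among those of
    \<open>E0\<close> and the count is exact.\<close>
  define W where "W = neighbors E y - {x} - neighbors E x"
  define E' where "E' = E0 \<union> (\<lambda>w. {w, x}) ` W"
  have finN: "finite (neighbors E y)" by (rule finite_neighbors[OF G])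
  have cE: "card E = card E0 + vertex_degree E y"
  proof -
    have "E = E0 \<union> {e \<in> E. y \<in> e}" "E0 \<inter> {e \<in> E. y \<in> e} = {}" by (auto simp: E0_def)
    then have "card E = card E0 + card {e \<in> E. y \<in> e}" using finE
      by (metis card_Un_disjoint finite_Un)
    then show ?thesis using card_incident_edges[OF G] by simp
  qed
  have cN: "vertex_degree E y = card W + card (neighbors E x \<inter> neighbors E y) + 1"
  proof -
    have "neighbors E y = insert x (W \<union> (neighbors E x \<inter> neighbors E y))"
      using xy by (auto simp: W_def nb)
    moreover have "x \<notin> W \<union> (neighbors E x \<inter> neighbors E y)" by (auto simp: W_def neighbors_def)
    moreover have "card (W \<union> (neighbors E x \<inter> neighbors E y)) = card W + card (neighbors E x \<inter> neighbors E y)"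
      by (rule card_Un_disjoint) (use finN in \<open>auto simp: W_def\<close>)
    ultimately show ?thesis unfolding vertex_degree_def
      by (metis Suc_eq_plus1 card_insert_disjoint finN finite_insert)
  qed
  have cE': "card E' = card E0 + card W"
  proof -
    have "E0 \<inter> (\<lambda>w. {w, x}) ` W = {}" by (auto simp: E0_def W_def nb)
    then have "card E' = card E0 + card ((\<lambda>w. {w, x}) ` W)" unfolding E'_def
      by (intro card_Un_disjoint) (use finE finN in \<open>auto simp: E0_def W_def\<close>)
    then show ?thesis by (simp add: card_image inj_on_edge)
  qed
  show ?thesis
  proof (rule that[of E'])
    have "w \<in> V \<and> w \<noteq> x \<and> w \<noteq> y" if "w \<in> W" for w using that adj[of w y] by (auto simp: W_def nb)
    then show "simple_graph (V - {y}) E'" using G x_y by (auto simp: simple_graph_def E'_def E0_def)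
    show "card E' + card (neighbors E x \<inter> neighbors E y) + 1 = card E"
      using cE cN cE' by simp
    assume K: "K33_minor (V - {y}) E'"
    show "K33_minor V E"
    proof (rule K33_minor_trans[OF K, of "\<lambda>z. if z = x then {x, y} else {z}"])
      fix z assume "z \<in> V - {y}"
      then show "(if z = x then {x, y} else {z}) \<subseteq> V \<and> connected_in E (if z = x then {x, y} else {z})"
        using x_y xy connected_in_star[of "{y}" x E] by (auto simp: connected_in_singleton)
    next
      fix u v assume uv: "{u, v} \<in> E'"
      then consider "{u, v} \<in> E" | w where "w \<in> W" "{u, v} = {w, x}" by (auto simp: E'_def E0_def)
      then show "\<exists>u'\<in>if u = x then {x, y} else {u}. \<exists>v'\<in>if v = x then {x, y} else {v}. {u', v'} \<in> E"
      proof cases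
        case 1
        then show ?thesis by (auto split: if_splits)
      next
        case 2
        then have "{w, y} \<in> E" "w \<noteq> x" by (auto simp: W_def nb)
        then show ?thesis using 2 by (auto simp: doubleton_eq_iff insert_commute)
      qed
    qed (use x_y in \<open>auto split: if_splits\<close>)
  qed
qed

text \<open>Inside the neighbourhood \<open>N\<close> each vertex misses at most one other. For a
  suitable pair \<open>a\<close>, \<open>b\<close> the remaining three vertices of \<open>N\<close>
  are therefore adjacent to both, and they are adjacent to \<open>v\<close> anyway.\<close>

lemma K33_minor_of_degree_5_vertex:
  assumes G: "simple_graph V E" and v: "v \<in> V" "vertex_degree E v = 5"
    and tri: "\<And>w. w \<in> neighbors E v \<Longrightarrow> 3 \<le> card (neighbors E w \<inter> neighbors E v)"
  shows "K33_minor V E"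
proof -
  define N where "N = neighbors E v"
  have N: "card N = 5" "finite N" "N \<subseteq> V" "v \<notin> N"
    using v finite_neighbors[OF G] neighbors_subset[OF G] by (auto simp: N_def vertex_degree_def neighbors_def)
  \<comment> \<open>A vertex \<open>w\<close> missing both \<open>y\<close> and \<open>z\<close>
    would have at most 5 - 3 = 2 neighbours in \<open>N\<close>.\<close>
  have adj: "{w, y} \<in> E \<or> {w, z} \<in> E" if w: "w \<in> N" "y \<in> N" "z \<in> N" "distinct [w, y, z]" for w y z
  proof (rule ccontr)
    assume "\<not> ?thesis"
    then have "neighbors E w \<inter> N \<subseteq> N - {w, y, z}"
      by (auto simp: neighbors_def insert_commute)
    moreover have "card (N - {w, y, z}) = 2"
      using w N by (simp add: card_Diff_subset)
    ultimately have "card (neighbors E w \<inter> N) \<le> 2"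
      using N(2) by (metis card_mono finite_Diff)
    then show False using tri[of w] w by (simp add: N_def)
  qed
  \<comment> \<open>A non-adjacent pair if there is one: all other members of \<open>N\<close> are then adjacent to both.\<close>
  obtain a b where ab: "a \<in> N" "b \<in> N" "a \<noteq> b"
    and ab_adj: "\<And>w. w \<in> N - {a, b} \<Longrightarrow> {a, w} \<in> E \<and> {b, w} \<in> E"
  proof (cases "\<exists>a\<in>N. \<exists>b\<in>N. a \<noteq> b \<and> {a, b} \<notin> E")
    case True
    then obtain a b where ab: "a \<in> N" "b \<in> N" "a \<noteq> b" "{a, b} \<notin> E" by blast
    show ?thesis
    proof (rule that[OF ab(1,2,3)])
      fix w assume "w \<in> N - {a, b}"
      then show "{a, w} \<in> E \<and> {b, w} \<in> E"
        using adj[of a b w] adj[of b a w] ab by (auto simp: insert_commute)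
    qed
  next
    case False
    have "2 \<le> card N" using N(1) by simp
    then obtain S where "S \<subseteq> N" "card S = 2" using obtain_subset_with_card_n by metis
    then obtain a b where ab: "a \<in> N" "b \<in> N" "a \<noteq> b" by (auto simp: card_2_iff)
    have all: "{x, y} \<in> E" if "x \<in> N" "y \<in> N" "x \<noteq> y" for x y using False that by blast
    show ?thesis by (rule that[OF ab]) (use ab in \<open>auto intro: all\<close>)
  qed
  have "card (N - {a, b}) = 3" using N ab by (simp add: card_Diff_subset)
  then obtain w p q where wpq: "N - {a, b} = {w, p, q}" "distinct [w, p, q]"
    by (auto simp: card_3_iff)
  have vN: "{v, x} \<in> E" if "x \<in> N" for x using that by (auto simp: N_def neighbors_def insert_commute)
  show ?thesis
  proof (rule K33_minor_five_vertices_and_connected_set[of v a b p q V "{w}"])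
    have "w \<in> N - {a, b}" "p \<in> N - {a, b}" "q \<in> N - {a, b}" using wpq by auto
    then show "distinct [v, a, b, p, q]" "{v, a, b, p, q} \<subseteq> V" "{w} \<subseteq> V" "{w} \<inter> {v, a, b, p, q} = {}"
      and "\<And>x. x \<in> {v, a, b} \<Longrightarrow> {x, p} \<in> E \<and> {x, q} \<in> E \<and> (\<exists>u\<in>{w}. {x, u} \<in> E)"
      using wpq(2) ab N v(1) vN ab_adj by auto
  qed (rule connected_in_singleton)
qed

text \<open>\<open>C\<close> is the least closed subset of \<open>W\<close> containing
  \<open>u\<close>. A closed part of \<open>C\<close> with \<open>u\<close> in it is everything; for
  one without \<open>u\<close> the complement in \<open>C\<close> is closed, because edges are
  symmetric, and so this complement is everything.\<close>

lemma component_exists: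
  assumes u: "u \<in> W"
  obtains C where "u \<in> C" "C \<subseteq> W" "connected_in E C"
    "\<And>x y. x \<in> C \<Longrightarrow> y \<in> W \<Longrightarrow> {x, y} \<in> E \<Longrightarrow> y \<in> C"
proof -
  define cl where "cl T \<longleftrightarrow> u \<in> T \<and> T \<subseteq> W \<and> (\<forall>x\<in>T. \<forall>y\<in>W. {x, y} \<in> E \<longrightarrow> y \<in> T)" for T
  define C where "C = \<Inter>{T. cl T}"
  have "cl W" using u by (auto simp: cl_def)
  then have C: "cl C" unfolding C_def cl_def by blast
  have least: "C \<subseteq> T" if "cl T" for T using that by (auto simp: C_def)
  have "connected_in E C" unfolding connected_in_def
  proof (intro conjI allI impI)
    show "C \<noteq> {}" using C by (auto simp: cl_def)
    fix T assume T: "T \<subseteq> C" "T \<noteq> {}" "\<forall>x\<in>T. \<forall>y\<in>C. {x, y} \<in> E \<longrightarrow> y \<in> T"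
    show "T = C"
    proof (cases "u \<in> T")
      case True
      then have "cl T" using T C unfolding cl_def by blast
      then show ?thesis using least T by blast
    next
      case False
      have "cl (C - T)" unfolding cl_def
      proof (intro conjI ballI impI)
        fix x y assume xy: "x \<in> C - T" "y \<in> W" "{x, y} \<in> E"
        then have "y \<in> C" using C unfolding cl_def by blast
        moreover have "y \<notin> T" using T(3) xy by (metis DiffD1 DiffD2 insert_commute)
        ultimately show "y \<in> C - T" by blast
      qed (use C False in \<open>auto simp: cl_def\<close>)
      then show ?thesis using least T by blast
    qed
  qed
  then show ?thesis using that[of C] C unfolding cl_def by blast
qed

text \<open>The constant is 5, not the 6 of planar graphs, because \<open>K\<^sub>5\<close> has 10
  edges and, with only five vertices, no \<open>K\<^sub>3\<^sub>,\<^sub>3\<close> minor. The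
  additive form avoids truncated subtraction.\<close>

theorem K33_minor_free_edge_bound:
  assumes "simple_graph V E" "2 \<le> card V" "\<not> K33_minor V E"
  shows "card E + 5 \<le> 3 * card V"
  using assms
proof (induction "card V" arbitrary: V E rule: less_induct)
  case less
  define n where "n = card V"
  show ?case
  proof (rule ccontr)
    assume "\<not> ?thesis"
    then have "3 * n - 4 \<le> card E" by (simp add: n_def)
    \<comment> \<open>Surplus edges are discarded. With exactly 3n - 4 edges, the induction
      hypothesis for a contraction becomes a statement about triangles.\<close>
    then obtain E0 where E0: "E0 \<subseteq> E" "card E0 = 3 * n - 4"
      by (meson obtain_subset_with_card_n)
    have G: "simple_graph V E0" using less.prems(1) E0 simple_graph_subset by blast
    have noK: "\<not> K33_minor V E0" using less.prems(3) K33_minor_mono[OF _ order_refl E0(1)] by blast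
    have finV: "finite V" and finE: "finite E0" using G simple_graph_finite_edges by (auto simp: simple_graph_def)
    have n3: "3 \<le> n"
    proof (rule ccontr)
      assume "\<not> 3 \<le> n"
      then have n2: "n = 2" using less.prems(2) by (simp add: n_def)
      have "e = V" if "e \<in> E0" for e
        using G that n2 finV card_subset_eq[of V e] by (auto simp: simple_graph_def n_def)
      then have "E0 \<subseteq> {V}" by blast
      then have "card E0 \<le> 1" using card_mono[of "{V}" E0] by simp
      then show False using E0 n2 by simp
    qed
    have IH: "card E' + 5 \<le> 3 * card V'"
      if "V' \<subseteq> V" "V' \<noteq> V" "simple_graph V' E'" "2 \<le> card V'" "\<not> K33_minor V' E'" for V' E'
      using less.hyps[of V' E'] that psubset_card_mono[OF finV] by blast
    \<comment> \<open>With t common neighbours, contracting \<open>{x, y}\<close> leaves 3n - 5 - t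
      edges on n - 1 vertices, where at most 3n - 8 are allowed.\<close>
    have tri: "3 \<le> card (neighbors E0 x \<inter> neighbors E0 y)" if xy: "{x, y} \<in> E0" for x y
    proof -
      obtain E' where E': "simple_graph (V - {y}) E'"
          "card E' + card (neighbors E0 x \<inter> neighbors E0 y) + 1 = card E0"
          "K33_minor (V - {y}) E' \<Longrightarrow> K33_minor V E0"
        using contract_edge[OF G xy] by blast
      have y: "y \<in> V" using simple_graph_adj[OF G xy] by blast
      then have "card (V - {y}) = n - 1" by (simp add: n_def)
      then have "card E' + 5 \<le> 3 * (n - 1)" using IH[of "V - {y}" E'] E'(1,3) noK y n3 by force
      then show ?thesis using E'(2) E0(2) n3 by simp
    qed
    \<comment> \<open>The degree sum is 6n - 8, which is below 6n.\<close>
    obtain v where v: "v \<in> V" "vertex_degree E0 v \<le> 5"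
    proof (rule ccontr)
      assume "\<not> thesis"
      then have "6 \<le> vertex_degree E0 v" if "v \<in> V" for v using that \<open>\<And>v. _ \<Longrightarrow> _ \<Longrightarrow> thesis\<close> by force
      then have "(\<Sum>v\<in>V. 6) \<le> (\<Sum>v\<in>V. vertex_degree E0 v)" by (intro sum_mono) auto
      then have "6 * n \<le> 2 * card E0" using sum_vertex_degree[OF G] by (simp add: n_def)
      then show False using E0(2) n3 by simp
    qed
    define N where "N = neighbors E0 v"
    have N: "finite N" "N \<subseteq> V" "v \<notin> N" "card N = vertex_degree E0 v"
      using finite_neighbors[OF G] neighbors_subset[OF G] by (auto simp: N_def vertex_degree_def neighbors_def)
    have triN: "3 \<le> card (neighbors E0 w \<inter> N)" if "w \<in> N" for w
      using tri[of w v] that mem_neighbors[OF G] by (simp add: N_def)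
    have subN: "neighbors E0 w \<inter> N \<subseteq> N - {w}" for w by (auto simp: neighbors_def)
    have "N \<noteq> {}"
    proof
      assume "N = {}"
      then have "v \<notin> e" if "e \<in> E0" for e
        using incident_edges[OF G, of v] that unfolding N_def by blast
      then have "simple_graph (V - {v}) E0" using G by (auto simp: simple_graph_def)
      moreover have "\<not> K33_minor (V - {v}) E0" using noK K33_minor_mono[of "V - {v}" E0 V E0] by blast
      moreover have "card (V - {v}) = n - 1" using v by (simp add: n_def)
      ultimately have "card E0 + 5 \<le> 3 * (n - 1)" using IH[of "V - {v}" E0] v n3 by force
      then show False using E0(2) n3 by simp
    qed
    then obtain w where w: "w \<in> N" by blast
    \<comment> \<open>A neighbour of \<open>v\<close> shares three neighbours with \<open>v\<close>,
      so the degree of \<open>v\<close> is 4 or 5, and 5 gives the minor. With degree 4 the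
      neighbours are pairwise adjacent, and \<open>K\<close> is a \<open>K\<^sub>5\<close>.\<close>
    have "card N \<noteq> 5"
      using K33_minor_of_degree_5_vertex[OF G v(1)] triN N noK unfolding N_def by auto
    moreover have "4 \<le> card N"
    proof -
      have "3 \<le> card (N - {w})" using triN[OF w] card_mono[OF _ subN[of w]] N(1) by fastforce
      then show ?thesis using w N(1) by (simp add: card_Diff_singleton)
    qed
    ultimately have cN: "card N = 4" using v(2) N(4) by simp
    define K where "K = insert v N"
    have K: "finite K" "K \<subseteq> V" "card K = 5" using N cN v by (auto simp: K_def)
    have K_adj: "{x, y} \<in> E0" if xy: "x \<in> K" "y \<in> K" "x \<noteq> y" for x y
    proof -
      have NN: "{x, y} \<in> E0" if "x \<in> N" "y \<in> N" "x \<noteq> y" for x y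
      proof -
        have "neighbors E0 y \<inter> N = N - {y}"
        proof (rule card_subset_eq)
          show "card (neighbors E0 y \<inter> N) = card (N - {y})"
            using triN[OF that(2)] that(2) N(1) cN card_mono[OF _ subN[of y]] by (simp add: card_Diff_singleton)
        qed (use N subN in auto)
        then have "x \<in> neighbors E0 y" using that by blast
        then show ?thesis by (simp add: neighbors_def)
      qed
      have "{v, x} \<in> E0" "{x, v} \<in> E0" if "x \<in> N" for x
        using that by (auto simp: N_def neighbors_def insert_commute)
      then show ?thesis using NN xy by (auto simp: K_def)
    qed
    \<comment> \<open>Five vertices carry at most 10 edges, but 3n - 4 would be 11.\<close>
    have "V \<noteq> K"
    proof
      assume "V = K"
      then have "n = 5" using K by (simp add: n_def)
      have "E0 \<subseteq> {e. e \<subseteq> K \<and> card e = 2}" using G \<open>V = K\<close> by (auto simp: simple_graph_def)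
      then have "card E0 \<le> card {e. e \<subseteq> K \<and> card e = 2}" using K by (intro card_mono) auto
      also have "\<dots> = 10" using n_subsets[OF K(1), of 2] K(3) by (simp add: choose_two)
      finally show False using E0(2) \<open>n = 5\<close> by simp
    qed
    then obtain u where u: "u \<in> V - K" using K by blast
    obtain C where C: "u \<in> C" "C \<subseteq> V - K" "connected_in E0 C"
        and C_cl: "\<And>x y. x \<in> C \<Longrightarrow> y \<in> V - K \<Longrightarrow> {x, y} \<in> E0 \<Longrightarrow> y \<in> C"
      using component_exists[OF u, of E0] by blast
    define S where "S = {k \<in> K. \<exists>x\<in>C. {k, x} \<in> E0}"
    have S: "S \<subseteq> K" "finite S" using K by (auto simp: S_def)
    \<comment> \<open>Three vertices of \<open>K\<close> attached to \<open>C\<close> would form a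
      \<open>K\<^sub>3\<^sub>,\<^sub>3\<close> minor with \<open>C\<close> and the other two
      vertices of \<open>K\<close>.\<close>
    have "card S \<le> 2"
    proof (rule ccontr)
      assume "\<not> card S \<le> 2"
      then have "3 \<le> card S" by simp
      then obtain T where T: "T \<subseteq> S" "card T = 3" by (meson obtain_subset_with_card_n)
      have "card (K - T) = 2" using T S K by (subst card_Diff_subset) (auto intro: finite_subset)
      then obtain p q where pq: "K - T = {p, q}" "p \<noteq> q" by (meson card_2_iff)
      obtain x y z where xyz: "T = {x, y, z}" "distinct [x, y, z]" using T(2) by (auto simp: card_3_iff)
      have K_eq: "p \<in> K" "q \<in> K" "p \<notin> T" "q \<notin> T" using pq by auto
      have "K33_minor V E0"
      proof (rule K33_minor_five_vertices_and_connected_set[of x y z p q V C])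
        show "distinct [x, y, z, p, q]" using xyz pq K_eq by auto
        show "{x, y, z, p, q} \<subseteq> V" "C \<subseteq> V" "C \<inter> {x, y, z, p, q} = {}"
          using xyz K_eq K C T S by auto
        fix w assume "w \<in> {x, y, z}"
        then have "w \<in> S" "w \<in> K" "w \<noteq> p" "w \<noteq> q" using xyz K_eq T S by auto
        then show "{w, p} \<in> E0 \<and> {w, q} \<in> E0 \<and> (\<exists>u\<in>C. {w, u} \<in> E0)"
          using K_adj K_eq by (auto simp: S_def)
      qed (rule C(3))
      then show False using noK by blast
    qed
    \<comment> \<open>\<open>S\<close> is padded to two vertices of \<open>K\<close>, hence to an
      edge, along which the graph splits into parts on \<open>C\<close> \<union> \<open>S'\<close>
      and on \<open>V - C\<close>.\<close>
    then obtain S' where S': "S \<subseteq> S'" "S' \<subseteq> K" "card S' = 2"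
      using exists_subset_between[of S 2 K] S K by auto
    then obtain a b where ab: "S' = {a, b}" "a \<noteq> b" by (meson card_2_iff)
    define E1 where "E1 = {e \<in> E0. e \<subseteq> C \<union> S'}"
    define E2 where "E2 = {e \<in> E0. e \<subseteq> V - C}"
    have finC: "finite C" "C \<subseteq> V" using C finV finite_subset by blast+
    have cover: "E0 \<subseteq> E1 \<union> E2"
    proof
      fix e assume e: "e \<in> E0"
      show "e \<in> E1 \<union> E2"
      proof (cases "e \<inter> C = {}")
        case True
        then show ?thesis using e G by (auto simp: E2_def simple_graph_def)
      next
        case False
        then obtain x where x: "x \<in> e" "x \<in> C" by blast
        obtain y where y: "e = {y, x}" "y \<in> V" using simple_graph_edge[OF G e x(1)] by blast
        have "y \<in> C \<union> S"
          using C_cl[of x y] x y e by (cases "y \<in> K") (auto simp: S_def insert_commute)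
        then show ?thesis using x y e S' by (auto simp: E1_def)
      qed
    qed
    \<comment> \<open>The edge \<open>S'\<close> lies in both parts, so they have at least 3n - 3
      edges together, whereas induction allows 3 (|C| + 2) - 5 plus 3 (n - |C|) - 5, that is 3n -
      4.\<close>
    have "S' \<in> E0" using K_adj[of a b] ab S' by auto
    moreover have "S' \<subseteq> V - C" using S' K C by blast
    ultimately have "S' \<in> E1 \<inter> E2" by (auto simp: E1_def E2_def)
    moreover have fin12: "finite E1" "finite E2" using finE by (auto simp: E1_def E2_def)
    ultimately have "1 \<le> card (E1 \<inter> E2)" by (metis One_nat_def Suc_leI card_gt_0_iff empty_iff finite_Int)
    then have m: "card E0 + 1 \<le> card E1 + card E2"
      using card_Un_Int[OF fin12] card_mono[OF _ cover] fin12 by simp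
    have cC: "card (C \<union> S') = card C + 2" 
      using S' C finC K by (subst card_Un_disjoint) (auto intro: finite_subset)
    have cVC: "card (V - C) + card C = n"
      using finC finV by (simp add: card_Diff_subset n_def card_mono)
    have "card C \<ge> 1" using C(1) finC by (metis One_nat_def Suc_leI card_gt_0_iff empty_iff)
    have "card E1 + 5 \<le> 3 * card (C \<union> S')"
    proof (rule IH)
      show "C \<union> S' \<subseteq> V" using finC S' K by blast
      have "card K \<le> card S'" if "K \<subseteq> S'" using that S' K by (metis card_mono card.infinite numeral_neq_zero)
      then have "\<not> K \<subseteq> S'" using S' K by auto
      then show "C \<union> S' \<noteq> V" using C K by blast
      show "simple_graph (C \<union> S') E1" using G \<open>C \<union> S' \<subseteq> V\<close> finV finite_subset
        by (auto simp: simple_graph_def E1_def)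
      show "\<not> K33_minor (C \<union> S') E1" using noK K33_minor_mono[of "C \<union> S'" E1 V E0] \<open>C \<union> S' \<subseteq> V\<close>
        by (auto simp: E1_def)
      show "2 \<le> card (C \<union> S')" using cC by simp
    qed
    moreover have "card E2 + 5 \<le> 3 * card (V - C)"
    proof (rule IH)
      show "simple_graph (V - C) E2" using G by (auto simp: simple_graph_def E2_def)
      show "\<not> K33_minor (V - C) E2" using noK K33_minor_mono[of "V - C" E2 V E0] by (auto simp: E2_def)
      have "K \<subseteq> V - C" using K C by blast
      then have "card K \<le> card (V - C)" using finV by (intro card_mono) auto
      then show "2 \<le> card (V - C)" using K by simp
    qed (use C u in auto)
    ultimately show False using m cC cVC E0(2) n3 by simp
  qed
qed

section \<open>Planar graphs\<close>

text \<open>The drawing of the subgraph induced by \<open>S\<close>; it turns branch sets into the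
  plane sets that \<open>no_K33_of_continua\<close> asks for.\<close>

definition drawing_region :: "('a \<Rightarrow> complex) \<Rightarrow> ('a set \<Rightarrow> real \<Rightarrow> complex) \<Rightarrow> 'a set set \<Rightarrow> 'a set \<Rightarrow> complex set" where
  "drawing_region p c E S = p ` S \<union> (\<Union>e\<in>{e \<in> E. e \<subseteq> S}. path_image (c e))"

lemma plane_drawingD:
  assumes "plane_drawing V E p c"
  shows "inj_on p V"
    and "e \<in> E \<Longrightarrow> arc (c e)"
    and "e \<in> E \<Longrightarrow> {pathstart (c e), pathfinish (c e)} = p ` e"
    and "e \<in> E \<Longrightarrow> path_image (c e) \<inter> p ` V = p ` e"
    and "e \<in> E \<Longrightarrow> e' \<in> E \<Longrightarrow> e \<noteq> e' \<Longrightarrow> path_image (c e) \<inter> path_image (c e') = p ` (e \<inter> e')"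
  using assms unfolding plane_drawing_def by simp_all

lemma closed_drawing_region:
  assumes G: "simple_graph V E" and D: "plane_drawing V E p c" and S: "S \<subseteq> V"
  shows "closed (drawing_region p c E S)"
proof -
  have "finite S" using G S finite_subset by (auto simp: simple_graph_def)
  moreover have "finite {e \<in> E. e \<subseteq> S}" using simple_graph_finite_edges[OF G] by simp
  moreover have "closed (path_image (c e))" if "e \<in> E" for e
    using plane_drawingD(2)[OF D that] by (simp add: arc_imp_path closed_path_image)
  ultimately show ?thesis unfolding drawing_region_def
    by (intro closed_Un closed_UN finite_imp_closed) auto
qed

text \<open>The vertices whose points are reachable inside the region from a fixed one form a part
  of \<open>S\<close> closed under edges, hence all of \<open>S\<close>. Any other point lies on an
  edge and is joined to an end of it.\<close>

lemma path_connected_drawing_region: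
  assumes G: "simple_graph V E" and D: "plane_drawing V E p c" and S: "connected_in E S"
  shows "path_connected (drawing_region p c E S)"
proof -
  define R where "R = drawing_region p c E S"
  have edge: "path_component R x y"
    if "e \<in> E" "e \<subseteq> S" "x \<in> path_image (c e)" "y \<in> path_image (c e)" for e x y
  proof -
    have "path_component (path_image (c e)) x y"
      using path_connected_path_image[of "c e"] plane_drawingD(2)[OF D that(1)] that(3,4)
      by (simp add: arc_imp_path path_connected_component)
    moreover have "path_image (c e) \<subseteq> R" using that by (auto simp: R_def drawing_region_def)
    ultimately show ?thesis by (meson path_component_of_subset)
  qed
  have ends: "p v \<in> path_image (c e)" if "e \<in> E" "v \<in> e" for e v
  proof -
    have "p v \<in> {pathstart (c e), pathfinish (c e)}" using plane_drawingD(3)[OF D that(1)] that(2) by simp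
    then show ?thesis by auto
  qed
  obtain u where u: "u \<in> S" using S by (auto simp: connected_in_def)
  define T where "T = {v \<in> S. path_component R (p u) (p v)}"
  have "path_component R (p u) (p u)"
    using u by (intro path_component_refl) (auto simp: R_def drawing_region_def)
  then have "u \<in> T" using u by (simp add: T_def)
  have "T = S"
  proof -
    have "w \<in> T" if "v \<in> T" "w \<in> S" "{v, w} \<in> E" for v w
    proof -
      have "path_component R (p v) (p w)"
        using edge[OF that(3)] ends[OF that(3)] that by (simp add: T_def)
      then show ?thesis using that by (auto simp: T_def intro: path_component_trans)
    qed
    moreover have "T \<subseteq> S" by (auto simp: T_def)
    ultimately show ?thesis using S \<open>u \<in> T\<close> unfolding connected_in_def by blast
  qed
  have "path_component R (p u) x" if xR: "x \<in> R" for x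
  proof (cases "x \<in> p ` S")
    case True
    then show ?thesis using \<open>T = S\<close> by (auto simp: T_def)
  next
    case False
    then obtain e where e: "e \<in> E" "e \<subseteq> S" "x \<in> path_image (c e)"
      using xR by (auto simp: R_def drawing_region_def)
    have "card e = 2" using G e by (auto simp: simple_graph_def)
    then obtain v where v: "v \<in> e" by fastforce
    then have "path_component R (p v) x" using edge[OF e(1,2)] ends[OF e(1)] e(3) by blast
    moreover have "v \<in> T" using v e(2) \<open>T = S\<close> by blast
    ultimately show ?thesis by (auto simp: T_def intro: path_component_trans)
  qed
  then have "path_connected R" unfolding path_connected_component
    by (meson path_component_sym path_component_trans)
  then show ?thesis by (simp add: R_def)
qed

text \<open>Excluding \<open>e \<subseteq> S\<close> makes \<open>e\<close> differ from every edge
  of the region, so it meets their arcs only at common ends, and it passes through no vertices but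
  its own.\<close>

lemma edge_Int_drawing_region:
  assumes D: "plane_drawing V E p c" and S: "S \<subseteq> V" and e: "e \<in> E" "e \<subseteq> V" "\<not> e \<subseteq> S"
  shows "path_image (c e) \<inter> drawing_region p c E S = p ` (e \<inter> S)"
proof
  have "p ` e \<subseteq> path_image (c e)" using plane_drawingD(4)[OF D e(1)] by blast
  then show "p ` (e \<inter> S) \<subseteq> path_image (c e) \<inter> drawing_region p c E S"
    by (auto simp: drawing_region_def)
  show "path_image (c e) \<inter> drawing_region p c E S \<subseteq> p ` (e \<inter> S)"
  proof
    fix x assume x: "x \<in> path_image (c e) \<inter> drawing_region p c E S"
    then consider s where "s \<in> S" "x = p s" | e' where "e' \<in> E" "e' \<subseteq> S" "x \<in> path_image (c e')"
      by (auto simp: drawing_region_def)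
    then show "x \<in> p ` (e \<inter> S)"
    proof cases
      case 1
      then have "x \<in> p ` e" using plane_drawingD(4)[OF D e(1)] x S by blast
      then obtain t where "t \<in> e" "x = p t" by blast
      then have "s = t" using plane_drawingD(1)[OF D] 1 e(2) S by (auto dest: inj_onD)
      then show ?thesis using 1 \<open>t \<in> e\<close> by blast
    next
      case 2
      then have "x \<in> p ` (e \<inter> e')" using plane_drawingD(5)[OF D e(1), of e'] e(3) x by blast
      then show ?thesis using 2 by blast
    qed
  qed
qed

lemma drawing_region_disjoint:
  assumes G: "simple_graph V E" and D: "plane_drawing V E p c" and S: "S \<subseteq> V" "T \<subseteq> V" "S \<inter> T = {}"
  shows "drawing_region p c E S \<inter> drawing_region p c E T = {}"
proof -
  have e: "path_image (c e) \<inter> drawing_region p c E T = {}" if "e \<in> E" "e \<subseteq> S" for e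
  proof -
    have "e \<noteq> {}" using G that by (auto simp: simple_graph_def)
    then have "\<not> e \<subseteq> T" "e \<inter> T = {}" using that S by blast+
    then show ?thesis using edge_Int_drawing_region[OF D S(2) that(1)] that S by auto
  qed
  have "p s \<notin> drawing_region p c E T" if s: "s \<in> S" for s
  proof
    assume "p s \<in> drawing_region p c E T"
    then consider t where "t \<in> T" "p s = p t" | e' where "e' \<in> E" "e' \<subseteq> T" "p s \<in> path_image (c e')"
      by (auto simp: drawing_region_def)
    then show False
    proof cases
      case 1
      then have "s = t" using plane_drawingD(1)[OF D] s S by (auto dest: inj_onD)
      then show False using 1 s S by blast
    next
      case 2
      then have "p s \<in> p ` e'" using plane_drawingD(4)[OF D 2(1)] s S by blast
      then obtain t where "t \<in> e'" "p s = p t" by blast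
      then have "s = t" using plane_drawingD(1)[OF D] s 2 S by (auto dest!: inj_onD)
      then show False using 2 \<open>t \<in> e'\<close> s S by blast
    qed
  qed
  then show ?thesis using e unfolding drawing_region_def[of p c E S] by blast
qed

text \<open>The regions of the six branch sets, with one drawn edge for each pair of opposite sets,
  form the configuration excluded by \<open>no_K33_of_continua\<close>.\<close>

theorem planar_graph_no_K33_minor:
  assumes G: "simple_graph V E" and planar: "planar_graph V E"
  shows "\<not> K33_minor V E"
proof
  assume "K33_minor V E"
  then obtain A B :: "nat \<Rightarrow> 'a set" where
    AB: "\<forall>i<3. A i \<subseteq> V \<and> B i \<subseteq> V \<and> connected_in E (A i) \<and> connected_in E (B i)"
    and AB_disj: "\<forall>i<3. \<forall>j<3. i \<noteq> j \<longrightarrow> A i \<inter> A j = {} \<and> B i \<inter> B j = {}"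
    and AB_edge: "\<forall>i<3. \<forall>j<3. A i \<inter> B j = {} \<and> (\<exists>u\<in>A i. \<exists>v\<in>B j. {u, v} \<in> E)"
    unfolding K33_minor_def by (elim exE conjE)
  obtain p c where D: "plane_drawing V E p c" using planar by (auto simp: planar_graph_def)
  let ?R = "drawing_region p c E"
  have sub: "A i \<subseteq> V" "B i \<subseteq> V" "connected_in E (A i)" "connected_in E (B i)" if "i < 3" for i
    using AB that by auto
  have disj: "A i \<inter> A j = {}" "B i \<inter> B j = {}" if "i < 3" "j < 3" "i \<noteq> j" for i j
    using AB_disj that by auto
  have ABd: "A i \<inter> B j = {}" if "i < 3" "j < 3" for i j using AB_edge that by auto
  have "\<forall>i j. \<exists>u v. i < 3 \<longrightarrow> j < 3 \<longrightarrow> u \<in> A i \<and> v \<in> B j \<and> {u, v} \<in> E"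
    using AB_edge by blast
  then obtain u v where uv: "\<And>i j. i < 3 \<Longrightarrow> j < 3 \<Longrightarrow> u i j \<in> A i \<and> v i j \<in> B j \<and> {u i j, v i j} \<in> E"
    by metis
  define e where "e i j = {u i j, v i j}" for i j
  have e: "e i j \<in> E" "e i j \<subseteq> V" "e i j \<inter> A i = {u i j}" "e i j \<inter> B j = {v i j}"
    if "i < 3" "j < 3" for i j
    using uv[OF that] ABd[OF that] sub(1)[OF that(1)] sub(2)[OF that(2)] by (auto simp: e_def)
  have eA: "e i j \<inter> A k = {}" if "i < 3" "j < 3" "k < 3" "k \<noteq> i" for i j k
    using uv[OF that(1,2)] ABd[OF that(3,2)] disj(1)[OF that(1,3)] that(4) by (auto simp: e_def)
  have eB: "e i j \<inter> B k = {}" if "i < 3" "j < 3" "k < 3" "k \<noteq> j" for i j k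
    using uv[OF that(1,2)] ABd[OF that(1,3)] disj(2)[OF that(2,3)] that(4) by (auto simp: e_def)
  have e_sub: "\<not> e i j \<subseteq> A k" "\<not> e i j \<subseteq> B k" if "i < 3" "j < 3" "k < 3" for i j k
    using uv[OF that(1,2)] ABd[OF that(3,2)] ABd[OF that(1,3)] by (auto simp: e_def)
  \<comment> \<open>The drawing does not prescribe in which direction an edge is traversed; each arc
    is turned so as to run from \<open>B j\<close> to \<open>A i\<close>.\<close>
  have "\<exists>g. arc g \<and> path_image g = path_image (c (e i j)) \<and> pathstart g = p (v i j) \<and> pathfinish g = p (u i j)"
    if ij: "i < 3" "j < 3" for i j
  proof -
    have "{pathstart (c (e i j)), pathfinish (c (e i j))} = {p (u i j), p (v i j)}"
      using plane_drawingD(3)[OF D e(1)[OF ij]] by (simp add: e_def)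
    then consider "pathstart (c (e i j)) = p (v i j)" "pathfinish (c (e i j)) = p (u i j)"
      | "pathstart (c (e i j)) = p (u i j)" "pathfinish (c (e i j)) = p (v i j)"
      by (auto simp: doubleton_eq_iff)
    then show ?thesis
    proof cases
      case 1
      then show ?thesis using plane_drawingD(2)[OF D e(1)[OF ij]] by blast
    next
      case 2
      then show ?thesis using plane_drawingD(2)[OF D e(1)[OF ij]]
        by (intro exI[of _ "reversepath (c (e i j))"]) (simp add: arc_reversepath)
    qed
  qed
  then have "\<forall>i j. \<exists>g. i < 3 \<longrightarrow> j < 3 \<longrightarrow> arc g \<and> path_image g = path_image (c (e i j)) \<and>
      pathstart g = p (v i j) \<and> pathfinish g = p (u i j)" by blast
  then obtain g where g: "\<And>i j. i < 3 \<Longrightarrow> j < 3 \<Longrightarrow> arc (g i j) \<and> path_image (g i j) = path_image (c (e i j)) \<and>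
      pathstart (g i j) = p (v i j) \<and> pathfinish (g i j) = p (u i j)" by metis
  have gR: "path_image (g i j) \<inter> ?R S = p ` (e i j \<inter> S)"
    if "i < 3" "j < 3" "S \<subseteq> V" "\<not> e i j \<subseteq> S" for i j S
    using g[OF that(1,2)] edge_Int_drawing_region[OF D that(3) e(1,2)[OF that(1,2)] that(4)] by simp
  show False
  proof (rule no_K33_of_continua[of "\<lambda>i. ?R (A i)" "\<lambda>i. ?R (B i)" "\<lambda>j i. g i j"])
    fix i assume i: "i < (3::nat)"
    show "closed (?R (A i)) \<and> path_connected (?R (A i))"
      using closed_drawing_region[OF G D] path_connected_drawing_region[OF G D] sub[OF i] by blast
    show "closed (?R (B i)) \<and> path_connected (?R (B i))"
      using closed_drawing_region[OF G D] path_connected_drawing_region[OF G D] sub[OF i] by blast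
    fix j assume j: "j < (3::nat)"
    show "?R (A i) \<inter> ?R (A j) = {}" "?R (B i) \<inter> ?R (B j) = {}" if "i \<noteq> j"
      using drawing_region_disjoint[OF G D] sub[OF i] sub[OF j] disj[OF i j that] by blast+
    show "?R (A i) \<inter> ?R (B j) = {}"
      using drawing_region_disjoint[OF G D] sub[OF i] sub[OF j] ABd[OF i j] by blast
    show "arc (g i j)" using g[OF i j] by blast
    show "path_image (g i j) \<inter> ?R (B j) = {pathstart (g i j)}"
      using gR[OF i j sub(2)[OF j] e_sub(2)[OF i j j]] e(4)[OF i j] g[OF i j] by simp
    show "path_image (g i j) \<inter> ?R (A i) = {pathfinish (g i j)}"
      using gR[OF i j sub(1)[OF i] e_sub(1)[OF i j i]] e(3)[OF i j] g[OF i j] by simp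
    fix k assume k: "k < (3::nat)"
    show "path_image (g i j) \<inter> ?R (B k) = {}" if "k \<noteq> j"
      using gR[OF i j sub(2)[OF k] e_sub(2)[OF i j k]] eB[OF i j k that] by simp
    show "path_image (g i j) \<inter> ?R (A k) = {}" if "k \<noteq> i"
      using gR[OF i j sub(1)[OF k] e_sub(1)[OF i j k]] eA[OF i j k that] by simp
  next
    fix i j i' j' assume ij: "i < (3::nat)" "j < (3::nat)" "i' < (3::nat)" "j' < (3::nat)" "(i, j) \<noteq> (i', j')"
    \<comment> \<open>An edge chosen for \<open>(i, j)\<close> meets no \<open>A k\<close> or
      \<open>B k\<close> besides \<open>A i\<close> and \<open>B j\<close>, so different pairs have
      different edges.\<close>
    have "e i j \<noteq> e i' j'"
    proof (cases "i = i'")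
      case True
      then have "j' \<noteq> j" using ij by auto
      then show ?thesis using e(4)[OF ij(3,4)] eB[OF ij(1,2,4)] by auto
    next
      case False
      then show ?thesis using e(3)[OF ij(3,4)] eA[OF ij(1,2,3)] by auto
    qed
    then have "path_image (g i j) \<inter> path_image (g i' j') = p ` (e i j \<inter> e i' j')"
      using plane_drawingD(5)[OF D e(1)[OF ij(1,2)] e(1)[OF ij(3,4)]] g[OF ij(1,2)] g[OF ij(3,4)] by simp
    also have "\<dots> \<subseteq> ?R (A i) \<union> ?R (B j)"
      using uv[OF ij(1,2)] by (auto simp: e_def drawing_region_def)
    also have "\<dots> \<subseteq> (\<Union>k<3. ?R (A k) \<union> ?R (B k))" using ij(1,2) by blast
    finally show "path_image (g i j) \<inter> path_image (g i' j') \<subseteq> (\<Union>k<3. ?R (A k) \<union> ?R (B k))" .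
  qed
qed

section \<open>Double Roman bondage\<close>

text \<open>The condition at a single vertex, split off so that it can be carried over to another
  vertex, edge set or function.\<close>

definition DR_dominated :: "'a set set \<Rightarrow> ('a \<Rightarrow> nat) \<Rightarrow> 'a \<Rightarrow> bool" where
  "DR_dominated E f v \<longleftrightarrow>
     (f v = 0 \<longrightarrow> 2 \<le> card {u \<in> neighbors E v. f u = 2} \<or> (\<exists>w\<in>neighbors E v. f w = 3)) \<and>
     (f v = 1 \<longrightarrow> (\<exists>w\<in>neighbors E v. 2 \<le> f w))"

lemma DRDF_iff: "DRDF V E f \<longleftrightarrow> (\<forall>v\<in>V. f v \<le> 3 \<and> DR_dominated E f v)"
proof -
  have "f v \<in> {0, 1, 2, 3} \<longleftrightarrow> f v \<le> 3" for v by auto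
  then show ?thesis unfolding DRDF_def DR_dominated_def by auto
qed

lemma DR_dominated_by_3:
  assumes "w \<in> neighbors E v" "f w = 3"
  shows "DR_dominated E f v"
proof -
  have "2 \<le> f w" using assms by simp
  then show ?thesis using assms unfolding DR_dominated_def by blast
qed

text \<open>A neighbour of \<open>v\<close> with value 3 settles everything; without one, the
  neighbours that dominate \<open>x\<close> retain their values by \<open>keep\<close>.
  \<open>x\<close> and \<open>v\<close> are separate because one vertex may inherit the value of
  another along with its dominating neighbours.\<close>

lemma DR_dominated_transfer:
  assumes dom: "DR_dominated E' f' x" and f: "f v = f' x"
    and N: "neighbors E' x \<subseteq> neighbors E v" "finite (neighbors E v)"
    and keep: "\<And>u. u \<in> neighbors E' x \<Longrightarrow> 2 \<le> f' u \<Longrightarrow> f u = f' u \<or> f u = 3"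
  shows "DR_dominated E f v"
proof (cases "\<exists>w\<in>neighbors E v. f w = 3")
  case True
  then show ?thesis using DR_dominated_by_3 by metis
next
  case False
  then have eq: "f u = f' u" if "u \<in> neighbors E' x" "2 \<le> f' u" for u using keep[OF that] that(1) N(1) by blast
  have "{u \<in> neighbors E' x. f' u = 2} \<subseteq> {u \<in> neighbors E v. f u = 2}" using eq N(1) by auto
  then have "card {u \<in> neighbors E' x. f' u = 2} \<le> card {u \<in> neighbors E v. f u = 2}"
    using N(2) by (intro card_mono) auto
  moreover have "f w = 3" if "w \<in> neighbors E' x" "f' w = 3" for w using eq[of w] that by simp
  moreover have "2 \<le> f w" if "w \<in> neighbors E' x" "2 \<le> f' w" for w using eq[of w] that by simp
  ultimately show ?thesis using dom N(1) unfolding DR_dominated_def f by (meson le_trans subsetD)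
qed

lemma DR_dominated_isolated:
  assumes "DR_dominated E f v" "neighbors E v = {}"
  shows "2 \<le> f v"
proof (rule ccontr)
  assume "\<not> 2 \<le> f v"
  then have "f v = 0 \<or> f v = 1" by auto
  then show False using assms by (auto simp: DR_dominated_def)
qed

section \<open>Upper bounds for the double Roman bondage number\<close>

text \<open>Improving a function of least weight for \<open>E - B\<close> shows that deleting
  \<open>B\<close> raises \<open>gamma_dR\<close>.\<close>

lemma b_dR_le:
  assumes B: "B \<subseteq> E" "card B \<le> k"
    and improve: "\<And>f. DRDF V (E - B) f \<Longrightarrow> \<exists>f'. DRDF V E f' \<and> (\<Sum>v\<in>V. f' v) < (\<Sum>v\<in>V. f v)"
  shows "b_dR V E \<le> enat k"
proof -
  obtain f where f: "DRDF V (E - B) f" "gamma_dR V (E - B) = (\<Sum>v\<in>V. f v)"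
    using gamma_dR_attained by blast
  obtain f' where "DRDF V E f'" "(\<Sum>v\<in>V. f' v) < (\<Sum>v\<in>V. f v)" using improve[OF f(1)] by blast
  then have "gamma_dR V E < gamma_dR V (E - B)" using gamma_dR_le[of V E f'] f(2) by simp
  then have "b_dR V E \<le> enat (card B)" unfolding b_dR_def using B(1) by (intro INF_lower) auto
  then show ?thesis using B(2) by (meson enat_ord_simps(1) order_trans)
qed

text \<open>\<open>B\<close> isolates \<open>y\<close> and leaves \<open>x\<close> only neighbours
  that it shares with \<open>y\<close> in the whole graph. The edge \<open>{x, y}\<close> is counted
  once and the edges from \<open>x\<close> to \<open>W\<close> are kept, which gives d(x) + d(y) - 1
  - |W| edges.\<close>

lemma b_dR_le_adjacent:
  assumes G: "simple_graph V E" and xy: "{x, y} \<in> E"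
    and k: "vertex_degree E x + vertex_degree E y \<le> k + 1 + card (neighbors E x \<inter> neighbors E y)"
  shows "b_dR V E \<le> enat k"
proof -
  note nb = mem_neighbors[OF G]
  have finV: "finite V" using G by (simp add: simple_graph_def)
  have x_y: "x \<noteq> y" "x \<in> V" "y \<in> V" using simple_graph_adj[OF G xy] by auto
  define W where "W = neighbors E x \<inter> neighbors E y"
  define B where "B = {e \<in> E. y \<in> e} \<union> (\<lambda>w. {w, x}) ` (neighbors E x - insert y W)"
  have W: "finite W" "W \<subseteq> neighbors E x" "y \<notin> W" using finite_neighbors[OF G] by (auto simp: W_def neighbors_def)
  have yN: "y \<in> neighbors E x" using xy by (simp add: nb insert_commute)
  have BE: "B \<subseteq> E" by (auto simp: B_def nb)
  have "card B \<le> vertex_degree E y + card (neighbors E x - insert y W)"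
  proof -
    have "card B \<le> card {e \<in> E. y \<in> e} + card ((\<lambda>w. {w, x}) ` (neighbors E x - insert y W))"
      unfolding B_def by (rule card_Un_le)
    then show ?thesis by (simp add: card_incident_edges[OF G] card_image inj_on_edge)
  qed
  moreover have "card (neighbors E x - insert y W) + card W + 1 = vertex_degree E x"
  proof -
    have "card (insert y W) \<le> card (neighbors E x)" using W yN finite_neighbors[OF G] by (intro card_mono) auto
    then show ?thesis using W yN by (simp add: card_Diff_subset vertex_degree_def)
  qed
  ultimately have cB: "card B \<le> k" using k by (simp add: W_def)
  define E' where "E' = E - B"
  have sub: "neighbors E' v \<subseteq> neighbors E v" for v by (auto simp: E'_def neighbors_def)
  have Ny: "neighbors E' y = {}" by (auto simp: E'_def B_def neighbors_def)
  have y_iso: "y \<notin> neighbors E' v" for v by (auto simp: E'_def B_def neighbors_def)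
  have Nx: "neighbors E' x \<subseteq> W" by (auto simp: E'_def B_def neighbors_def W_def)
  show ?thesis
  proof (rule b_dR_le[OF BE cB])
    fix f assume "DRDF V (E - B) f"
    then have f: "\<And>v. v \<in> V \<Longrightarrow> f v \<le> 3 \<and> DR_dominated E' f v" by (simp add: DRDF_iff E'_def)
    have fy: "2 \<le> f y" using DR_dominated_isolated f x_y Ny by metis
    show "\<exists>f'. DRDF V E f' \<and> (\<Sum>v\<in>V. f' v) < (\<Sum>v\<in>V. f v)"
    proof (cases "2 \<le> f x")
      case True
      \<comment> \<open>\<open>x\<close> and \<open>y\<close> have at least 2 each and now cost 3
        together.\<close>
      define f' where "f' = f(x := 3, y := 0)"
      have "DRDF V E f'" unfolding DRDF_iff
      proof (intro ballI conjI)
        fix v assume v: "v \<in> V"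
        show "f' v \<le> 3" using f[OF v] by (simp add: f'_def)
        show "DR_dominated E f' v"
        proof (cases "v = x \<or> v = y")
          case True
          then show ?thesis
          proof
            assume "v = x"
            then show ?thesis using x_y by (simp add: DR_dominated_def f'_def)
          next
            assume "v = y"
            then show ?thesis using DR_dominated_by_3[of x E y f'] xy x_y by (simp add: nb f'_def)
          qed
        next
          case False
          show ?thesis
            by (rule DR_dominated_transfer[OF conjunct2[OF f[OF v]] _ sub finite_neighbors[OF G]])
              (use False y_iso in \<open>auto simp: f'_def\<close>)
        qed
      qed
      moreover have "(\<Sum>v\<in>V. f' v) < (\<Sum>v\<in>V. f v)"
      proof -
        have "(\<Sum>v\<in>V. g v) = g x + g y + (\<Sum>v\<in>V - {x} - {y}. g v)" for g :: "'a \<Rightarrow> nat"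
          using x_y finV by (simp add: sum.remove[of V x] sum.remove[of "V - {x}" y])
        note this[of f] this[of f']
        moreover have "(\<Sum>v\<in>V - {x} - {y}. f' v) = (\<Sum>v\<in>V - {x} - {y}. f v)"
          by (rule sum.cong) (auto simp: f'_def)
        ultimately show ?thesis using True fy x_y by (simp add: f'_def)
      qed
      ultimately show ?thesis by blast
    next
      case False
      \<comment> \<open>What dominates \<open>x\<close> after the deletion lies among the common
        neighbours, so it dominates \<open>y\<close> as well; the value of \<open>y\<close> drops
        from at least 2 to at most 1.\<close>
      define f' where "f' = f(y := f x)"
      have "DRDF V E f'" unfolding DRDF_iff
      proof (intro ballI conjI)
        fix v assume v: "v \<in> V"
        show "f' v \<le> 3" using f[OF v] f[OF x_y(2)] by (simp add: f'_def)
        show "DR_dominated E f' v"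
        proof (cases "v = y")
          case True
          have N: "neighbors E' x \<subseteq> neighbors E v" using Nx True by (auto simp: W_def)
          show ?thesis
            by (rule DR_dominated_transfer[OF conjunct2[OF f[OF x_y(2)]] _ N finite_neighbors[OF G]])
              (use True y_iso in \<open>auto simp: f'_def\<close>)
        next
          case False
          show ?thesis
            by (rule DR_dominated_transfer[OF conjunct2[OF f[OF v]] _ sub finite_neighbors[OF G]])
              (use False y_iso in \<open>auto simp: f'_def\<close>)
        qed
      qed
      moreover have "(\<Sum>v\<in>V. f' v) < (\<Sum>v\<in>V. f v)"
        by (rule sum_strict_mono_ex1) (use finV x_y False fy in \<open>auto simp: f'_def\<close>)
      ultimately show ?thesis by blast
    qed
  qed
qed

text \<open>All edges at \<open>y\<close> and all edges at \<open>x\<close> except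
  \<open>{x, z}\<close> are deleted. Then \<open>y\<close> costs at least 2, and so do
  \<open>x\<close> and \<open>z\<close> together, whereas in the whole graph the value 3 at
  \<open>z\<close> serves all three vertices.\<close>

lemma b_dR_le_common_neighbor:
  assumes G: "simple_graph V E" and x_y: "x \<noteq> y" and xz: "{x, z} \<in> E" and yz: "{y, z} \<in> E"
    and k: "vertex_degree E x + vertex_degree E y \<le> k + 1"
  shows "b_dR V E \<le> enat k"
proof -
  note nb = mem_neighbors[OF G]
  have finV: "finite V" using G by (simp add: simple_graph_def)
  have xyz: "x \<noteq> z" "y \<noteq> z" "x \<in> V" "y \<in> V" "z \<in> V"
    using simple_graph_adj[OF G xz] simple_graph_adj[OF G yz] by auto
  define B where "B = {e \<in> E. y \<in> e} \<union> ({e \<in> E. x \<in> e} - {{x, z}})"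
  have BE: "B \<subseteq> E" by (auto simp: B_def)
  have fin: "finite {e \<in> E. x \<in> e}" using simple_graph_finite_edges[OF G] by simp
  have "{x, z} \<in> {e \<in> E. x \<in> e}" using xz by simp
  from card_Suc_Diff1[OF fin this] have "card ({e \<in> E. x \<in> e} - {{x, z}}) + 1 = vertex_degree E x"
    using card_incident_edges[OF G, of x] by simp
  then have cB: "card B \<le> k"
    using card_Un_le[of "{e \<in> E. y \<in> e}" "{e \<in> E. x \<in> e} - {{x, z}}"] card_incident_edges[OF G, of y] k
    unfolding B_def by simp
  define E' where "E' = E - B"
  have sub: "neighbors E' v \<subseteq> neighbors E v" for v by (auto simp: E'_def neighbors_def)
  have Ny: "neighbors E' y = {}" by (auto simp: E'_def B_def neighbors_def)
  have y_iso: "y \<notin> neighbors E' v" for v by (auto simp: E'_def B_def neighbors_def)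
  have Nx: "neighbors E' x \<subseteq> {z}" by (auto simp: E'_def B_def neighbors_def doubleton_eq_iff)
  \<comment> \<open>Only \<open>z\<close> can still see \<open>x\<close>, and \<open>z\<close> will
    get the value 3, so lowering \<open>x\<close> to 0 harms no other vertex.\<close>
  have x_iso: "x \<notin> neighbors E' v" if "v \<noteq> z" for v using Nx that neighbors_sym[of x E' v] by blast
  show ?thesis
  proof (rule b_dR_le[OF BE cB])
    fix f assume "DRDF V (E - B) f"
    then have f: "\<And>v. v \<in> V \<Longrightarrow> f v \<le> 3 \<and> DR_dominated E' f v" by (simp add: DRDF_iff E'_def)
    have fy: "2 \<le> f y" using DR_dominated_isolated f xyz Ny by metis
    \<comment> \<open>Otherwise \<open>x\<close> has value at most 1 and no neighbour of value 2 or
      more.\<close>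
    have fxz: "2 \<le> f x + f z"
    proof (rule ccontr)
      assume "\<not> ?thesis"
      then have small: "f x + f z \<le> 1" by simp
      have "{u \<in> neighbors E' x. f u = 2} = {}" using Nx small by auto
      then have c0: "card {u \<in> neighbors E' x. f u = 2} = 0" by (metis card.empty)
      have lt: "f w \<le> 1" if "w \<in> neighbors E' x" for w using Nx that small by auto
      have "DR_dominated E' f x" "f x = 0 \<or> f x = 1" using f[OF xyz(3)] small by auto
      then show False using c0 lt unfolding DR_dominated_def by fastforce
    qed
    define f' where "f' = f(x := 0, y := 0, z := 3)"
    have "DRDF V E f'" unfolding DRDF_iff
    proof (intro ballI conjI)
      fix v assume v: "v \<in> V"
      show "f' v \<le> 3" using f[OF v] by (simp add: f'_def)
      show "DR_dominated E f' v"
      proof (cases "v = z")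
        case True
        then show ?thesis by (simp add: DR_dominated_def f'_def)
      next
        case vz: False
        show ?thesis
        proof (cases "v = x \<or> v = y")
          case True
          then have "z \<in> neighbors E v" using xz yz by (auto simp: nb insert_commute)
          then show ?thesis by (rule DR_dominated_by_3) (simp add: f'_def)
        next
          case False
          show ?thesis
            by (rule DR_dominated_transfer[OF conjunct2[OF f[OF v]] _ sub finite_neighbors[OF G]])
              (use False vz y_iso x_iso in \<open>auto simp: f'_def\<close>)
        qed
      qed
    qed
    moreover have "(\<Sum>v\<in>V. f' v) < (\<Sum>v\<in>V. f v)"
    proof -
      have "(\<Sum>v\<in>V. g v) = g x + g y + g z + (\<Sum>v\<in>V - {x} - {y} - {z}. g v)" for g :: "'a \<Rightarrow> nat"
        using x_y xyz finV
        by (simp add: sum.remove[of V x] sum.remove[of "V - {x}" y] sum.remove[of "V - {x} - {y}" z])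
      note this[of f] this[of f']
      moreover have "(\<Sum>v\<in>V - {x} - {y} - {z}. f' v) = (\<Sum>v\<in>V - {x} - {y} - {z}. f v)"
        by (rule sum.cong) (auto simp: f'_def)
      ultimately show ?thesis using fxz fy x_y xyz by (simp add: f'_def)
    qed
    ultimately show "\<exists>f'. DRDF V E f' \<and> (\<Sum>v\<in>V. f' v) < (\<Sum>v\<in>V. f v)" by blast
  qed
qed

lemma graph_connected_degree_pos:
  assumes G: "simple_graph V E" and "graph_connected V E" "2 \<le> card V" "v \<in> V"
  shows "1 \<le> vertex_degree E v"
proof -
  have "V \<noteq> {v}" using assms(3) by auto
  then obtain u where u: "u \<in> V" "u \<noteq> v" using assms(4) by blast
  then have "(v, u) \<in> {(x, y). {x, y} \<in> E}\<^sup>*" using assms unfolding graph_connected_def by blast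
  then obtain w where "{v, w} \<in> E" using u(2) by (auto elim: converse_rtranclE)
  then have "w \<in> neighbors E v" by (simp add: mem_neighbors[OF G] insert_commute)
  then show ?thesis unfolding vertex_degree_def using finite_neighbors[OF G, of v]
    by (metis One_nat_def Suc_leI card_gt_0_iff empty_iff)
qed

section \<open>Contraction of the vertices of low degree\<close>

text \<open>Contracting the set \<open>L\<close> of low vertices yields a graph on \<open>V'\<close>
  for which 2 |E'| - 6 |V'| is the sum of \<open>d x - 6\<close> over \<open>V'\<close> plus the sum
  of \<open>2 * card (new v) - d v\<close> over \<open>L\<close>. Degrees in \<open>V'\<close> are
  at least 6 and the low vertices have disjoint neighbourhoods, so it suffices that each low vertex
  together with its neighbours contributes a nonnegative amount.\<close>

theorem K33_minor_of_large_degree_sums: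
  assumes G: "simple_graph V E" and V: "V \<noteq> {}"
    and pos: "\<And>v. v \<in> V \<Longrightarrow> 1 \<le> vertex_degree E v"
    and no5: "\<And>v. v \<in> V \<Longrightarrow> vertex_degree E v \<noteq> 5"
    and adj: "\<And>x y. {x, y} \<in> E \<Longrightarrow>
        9 + card (neighbors E x \<inter> neighbors E y) \<le> vertex_degree E x + vertex_degree E y"
    and dist2: "\<And>x y z. x \<noteq> y \<Longrightarrow> {x, z} \<in> E \<Longrightarrow> {y, z} \<in> E \<Longrightarrow>
        9 \<le> vertex_degree E x + vertex_degree E y"
  shows "K33_minor V E"
proof -
  note nb = mem_neighbors[OF G]
  define N where "N = neighbors E"
  define d where "d = vertex_degree E"
  define t where "t v x = card (N v \<inter> N x)" for v x
  have dN: "d v = card (N v)" for v by (simp add: d_def N_def vertex_degree_def)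
  have finN: "finite (N v)" for v unfolding N_def by (rule finite_neighbors[OF G])
  have finV: "finite V" using G by (simp add: simple_graph_def)
  have finE: "finite E" by (rule simple_graph_finite_edges[OF G])
  define L where "L = {v \<in> V. d v \<le> 4}"
  define V' where "V' = V - L"
  have finL: "finite L" using finV by (simp add: L_def)
  have adj': "9 + t v x \<le> d v + d x" if "x \<in> N v" for v x
    using adj[of v x] that by (simp add: N_def nb d_def t_def insert_commute)
  have big: "6 \<le> d x" if "x \<in> V'" for x
    using no5[of x] that by (force simp: V'_def L_def d_def)
  have NL: "N v \<subseteq> V'" if "v \<in> L" for v
  proof
    fix x assume x: "x \<in> N v"
    then have "x \<in> V" using neighbors_subset[OF G] by (auto simp: N_def)
    moreover have "4 < d x" using adj'[OF x] that by (simp add: L_def)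
    ultimately show "x \<in> V'" by (simp add: V'_def L_def)
  qed
  have NN: "N v \<inter> N w = {}" if "v \<in> L" "w \<in> L" "v \<noteq> w" for v w
  proof (rule ccontr)
    assume "\<not> ?thesis"
    then obtain z where "{v, z} \<in> E" "{w, z} \<in> E" by (auto simp: N_def nb insert_commute)
    then show False using dist2[OF that(3)] that by (force simp: L_def d_def)
  qed
  have "\<exists>a. a \<in> N v \<and> (\<forall>x. x \<in> N v \<longrightarrow> t v a \<le> t v x)" if "v \<in> L" for v
  proof -
    have "card (N v) \<noteq> 0" using pos[of v] that dN[of v] by (simp add: L_def d_def)
    then obtain x where "x \<in> N v" by fastforce
    then show ?thesis by (rule ex_has_least_nat)
  qed
  then obtain a where a: "\<And>v. v \<in> L \<Longrightarrow> a v \<in> N v" and a_min: "\<And>v x. v \<in> L \<Longrightarrow> x \<in> N v \<Longrightarrow> t v (a v) \<le> t v x"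
    by metis
  \<comment> \<open>\<open>W v\<close> holds the neighbours of \<open>v\<close> that become newly
    adjacent to \<open>a v\<close> when \<open>v\<close> is contracted into it.\<close>
  define W where "W v = N v - {a v} - N (a v)" for v
  define new where "new v = (\<lambda>b. {b, a v}) ` W v" for v
  define E1 where "E1 = {e \<in> E. e \<inter> L = {}}"
  define E' where "E' = E1 \<union> (\<Union>v\<in>L. new v)"
  have W: "finite (W v)" "W v \<subseteq> N v" for v using finN by (auto simp: W_def)
  have d_new: "d v = card (new v) + t v (a v) + 1" if v: "v \<in> L" for v
  proof -
    have "N v = insert (a v) (W v \<union> (N v \<inter> N (a v)))" using a[OF v] by (auto simp: W_def)
    moreover have "a v \<notin> W v \<union> (N v \<inter> N (a v))" by (auto simp: W_def N_def neighbors_def)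
    moreover have "card (W v \<union> (N v \<inter> N (a v))) = card (W v) + t v (a v)"
      unfolding t_def by (rule card_Un_disjoint) (use finN W in \<open>auto simp: W_def\<close>)
    ultimately have "d v = Suc (card (W v) + t v (a v))" unfolding dN
      by (metis card_insert_disjoint finN finite_insert)
    then show ?thesis by (simp add: new_def card_image inj_on_edge)
  qed
  have new_sub: "e \<subseteq> N v" "e \<noteq> {}" "e \<notin> E" if "v \<in> L" "e \<in> new v" for v e
    using that a[OF that(1)] by (auto simp: new_def W_def) (simp add: N_def nb)
  have cE: "card E = card E1 + (\<Sum>v\<in>L. d v)"
  proof -
    have "E = E1 \<union> (\<Union>v\<in>L. {e \<in> E. v \<in> e})" by (auto simp: E1_def)
    moreover have "E1 \<inter> (\<Union>v\<in>L. {e \<in> E. v \<in> e}) = {}" by (auto simp: E1_def)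
    ultimately have "card E = card E1 + card (\<Union>v\<in>L. {e \<in> E. v \<in> e})"
      by (metis card_Un_disjoint finE finite_Un)
    also have "card (\<Union>v\<in>L. {e \<in> E. v \<in> e}) = (\<Sum>v\<in>L. card {e \<in> E. v \<in> e})"
    proof (rule card_UN_disjoint[OF finL])
      show "\<forall>v\<in>L. \<forall>w\<in>L. v \<noteq> w \<longrightarrow> {e \<in> E. v \<in> e} \<inter> {e \<in> E. w \<in> e} = {}"
      proof (intro ballI impI, rule ccontr)
        fix v w assume vw: "v \<in> L" "w \<in> L" "v \<noteq> w" "{e \<in> E. v \<in> e} \<inter> {e \<in> E. w \<in> e} \<noteq> {}"
        then obtain e where e: "e \<in> E" "v \<in> e" "w \<in> e" by blast
        obtain u where u: "e = {u, v}" using simple_graph_edge[OF G e(1,2)] by blast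
        then have "w \<in> N v" using e vw(3) by (auto simp: N_def nb)
        then show False using NL[OF vw(1)] vw(2) by (auto simp: V'_def)
      qed
    qed (use finE in auto)
    finally show ?thesis using card_incident_edges[OF G] by (simp add: d_def)
  qed
  have cE': "card E' = card E1 + (\<Sum>v\<in>L. card (new v))"
  proof -
    have "E1 \<inter> (\<Union>v\<in>L. new v) = {}" using new_sub(3) by (auto simp: E1_def)
    then have "card E' = card E1 + card (\<Union>v\<in>L. new v)" unfolding E'_def
      by (intro card_Un_disjoint) (use finE finL W in \<open>auto simp: E1_def new_def\<close>)
    also have "card (\<Union>v\<in>L. new v) = (\<Sum>v\<in>L. card (new v))"
    proof (rule card_UN_disjoint[OF finL])
      show "\<forall>v\<in>L. \<forall>w\<in>L. v \<noteq> w \<longrightarrow> new v \<inter> new w = {}"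
      proof (intro ballI impI, rule ccontr)
        fix v w assume vw: "v \<in> L" "w \<in> L" "v \<noteq> w" "new v \<inter> new w \<noteq> {}"
        then obtain e where e: "e \<in> new v" "e \<in> new w" by blast
        show False
          using new_sub(1,2)[OF vw(1) e(1)] new_sub(1)[OF vw(2) e(2)] NN[OF vw(1-3)] by blast
      qed
    qed (use W in \<open>auto simp: new_def\<close>)
    finally show ?thesis .
  qed
  have local_count: "0 \<le> (\<Sum>x\<in>N v. int (d x) - 6) - int (d v) + 2 * int (card (new v))" if v: "v \<in> L" for v
  proof -
    define s where "s = t v (a v)"
    \<comment> \<open>\<open>m\<close> is a lower bound for every \<open>d x - 6\<close>: the degree
      of \<open>x\<close> is at least 6, and also at least \<open>9 + t v x - d v\<close>, where
      \<open>t v x\<close> is at least \<open>s\<close> by the choice of \<open>a v\<close>.\<close>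
    define m where "m = max 0 (3 - int (d v) + int s)"
    have "m \<le> int (d x) - 6" if x: "x \<in> N v" for x
      using adj'[OF x] a_min[OF v x] big[of x] NL[OF v] x by (auto simp: m_def s_def)
    then have "(\<Sum>x\<in>N v. m) \<le> (\<Sum>x\<in>N v. int (d x) - 6)" by (rule sum_mono)
    then have lower: "int (d v) * m \<le> (\<Sum>x\<in>N v. int (d x) - 6)" by (simp add: dN)
    have new_eq: "int (card (new v)) = int (d v) - int s - 1" using d_new[OF v] by (simp add: s_def)
    \<comment> \<open>Of the finitely many cases only \<open>d v = 4\<close>, \<open>s = 1\<close>
      is tight: then \<open>m = 0\<close>, and two new edges, counted twice, just balance
      \<open>d v\<close>.\<close>
    have "d v = 1 \<or> d v = 2 \<or> d v = 3 \<or> d v = 4" using pos[of v] v by (auto simp: L_def d_def)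
    moreover have "s + 1 \<le> d v" using d_new[OF v] by (simp add: s_def)
    ultimately have "0 \<le> int (d v) * m - int (d v) + 2 * (int (d v) - int s - 1)"
      by (auto simp: m_def max_def)
    also have "\<dots> \<le> (\<Sum>x\<in>N v. int (d x) - 6) - int (d v) + 2 * int (card (new v))"
      unfolding new_eq by (intro add_right_mono diff_right_mono lower)
    finally show ?thesis .
  qed
  have "3 * card V' \<le> card E'"
  proof -
    have sumV: "(\<Sum>v\<in>V. d v) = (\<Sum>v\<in>V'. d v) + (\<Sum>v\<in>L. d v)"
      unfolding V'_def using finV by (intro sum.subset_diff) (auto simp: L_def)
    \<comment> \<open>By disjointness no vertex of \<open>V'\<close> is used for two low vertices;
      those used for none contribute a nonnegative amount.\<close>
    have "(\<Sum>v\<in>L. \<Sum>x\<in>N v. int (d x) - 6) = (\<Sum>x\<in>(\<Union>v\<in>L. N v). int (d x) - 6)"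
      by (rule sum.UNION_disjoint[symmetric]) (use finL finN NN in auto)
    also have "\<dots> \<le> (\<Sum>x\<in>V'. int (d x) - 6)"
      using NL finV big by (intro sum_mono2) (auto simp: V'_def)
    also have "\<dots> = int (\<Sum>x\<in>V'. d x) - 6 * int (card V')"
      by (simp add: sum_subtractf)
    finally have 1: "(\<Sum>v\<in>L. \<Sum>x\<in>N v. int (d x) - 6) \<le> int (\<Sum>x\<in>V'. d x) - 6 * int (card V')" .
    have "0 \<le> (\<Sum>v\<in>L. (\<Sum>x\<in>N v. int (d x) - 6) - int (d v) + 2 * int (card (new v)))"
      by (rule sum_nonneg) (rule local_count)
    also have "\<dots> = (\<Sum>v\<in>L. \<Sum>x\<in>N v. int (d x) - 6) - int (\<Sum>v\<in>L. d v) + 2 * int (\<Sum>v\<in>L. card (new v))"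
      by (simp add: sum.distrib sum_subtractf sum_distrib_left)
    finally have "0 \<le> int (\<Sum>x\<in>V'. d x) - 6 * int (card V') - int (\<Sum>v\<in>L. d v) + 2 * int (\<Sum>v\<in>L. card (new v))"
      using 1 by linarith
    moreover have "(\<Sum>v\<in>V. d v) = 2 * card E" using sum_vertex_degree[OF G] by (simp add: d_def)
    ultimately have "6 * int (card V') \<le> 2 * int (card E')" using sumV cE cE' by linarith
    then show ?thesis by linarith
  qed
  moreover have G': "simple_graph V' E'"
  proof -
    have "e \<subseteq> V' \<and> card e = 2" if e: "e \<in> E'" for e
    proof (cases "e \<in> E1")
      case True
      then show ?thesis using G by (auto simp: E1_def V'_def simple_graph_def)
    next
      case False
      then obtain v where v: "v \<in> L" "e \<in> new v" using e by (auto simp: E'_def)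
      then have "card e = 2" by (auto simp: new_def W_def card_2_iff)
      then show ?thesis using new_sub(1)[OF v] NL[OF v(1)] by blast
    qed
    then show ?thesis using finV by (auto simp: simple_graph_def V'_def)
  qed
  \<comment> \<open>The edge bound requires two vertices. \<open>V'\<close> contains
    \<open>a v\<close> for every low \<open>v\<close>, so it is nonempty, and then the count forces
    an edge.\<close>
  moreover have "2 \<le> card V'"
  proof -
    have finV': "finite V'" using finV by (simp add: V'_def)
    have "V' \<noteq> {}" using V NL a by (auto simp: V'_def)
    then have "1 \<le> card V'" using finV' by (simp add: Suc_leI card_gt_0_iff)
    then have "card E' \<noteq> 0" using \<open>3 * card V' \<le> card E'\<close> by linarith
    then obtain e where "e \<in> E'" by fastforce
    then have "e \<subseteq> V'" "card e = 2" using G' by (auto simp: simple_graph_def)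
    then show ?thesis using card_mono[OF finV'] by metis
  qed
  ultimately have K: "K33_minor V' E'" using K33_minor_free_edge_bound[of V' E'] by linarith
  show ?thesis
  proof (rule K33_minor_trans[OF K, of "\<lambda>x. insert x {v \<in> L. a v = x}"])
    fix x assume x: "x \<in> V'"
    have "{x, v} \<in> E" if "v \<in> {v \<in> L. a v = x}" for v using a that by (auto simp: N_def nb)
    then have "connected_in E (insert x {v \<in> L. a v = x})" by (rule connected_in_star)
    then show "insert x {v \<in> L. a v = x} \<subseteq> V \<and> connected_in E (insert x {v \<in> L. a v = x})"
      using x by (auto simp: V'_def L_def)
  next
    fix x y assume "x \<in> V'" "y \<in> V'" "x \<noteq> y"
    then show "insert x {v \<in> L. a v = x} \<inter> insert y {v \<in> L. a v = y} = {}" by (auto simp: V'_def)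
  next
    fix x y assume xy: "{x, y} \<in> E'"
    show "\<exists>u\<in>insert x {v \<in> L. a v = x}. \<exists>w\<in>insert y {v \<in> L. a v = y}. {u, w} \<in> E"
    proof (cases "{x, y} \<in> E1")
      case True
      then show ?thesis by (auto simp: E1_def)
    next
      case False
      then obtain v where v: "v \<in> L" "{x, y} \<in> new v" using xy by (auto simp: E'_def)
      \<comment> \<open>A new edge \<open>{b, a v}\<close> is realised by the edge from
        \<open>b\<close> to \<open>v\<close>, which belongs to the branch set of
        \<open>a v\<close>.\<close>
      then obtain b where b: "b \<in> N v" "{x, y} = {b, a v}" by (auto simp: new_def W_def)
      then have "{b, v} \<in> E" "{v, b} \<in> E" by (auto simp: N_def nb insert_commute)
      moreover have "x = b \<and> y = a v \<or> x = a v \<and> y = b" using b(2) by (auto simp: doubleton_eq_iff)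
      ultimately show ?thesis using v(1) by blast
    qed
  qed
qed

theorem theorem3p9:
  fixes V :: "'a set" and E :: "'a set set"
  assumes "simple_graph V E"
    and "graph_connected V E"
    and "planar_graph V E"
    and "card V \<ge> 2"
    and "\<forall>v\<in>V. vertex_degree E v \<noteq> 5"
  shows "b_dR V E \<le> 7"
proof (rule ccontr)
  assume "\<not> b_dR V E \<le> 7"
  then have b: "\<not> b_dR V E \<le> enat 7" by (simp add: numeral_eq_enat)
  have "K33_minor V E"
  \<comment> \<open>If the bondage number exceeds 7, both upper bounds must fail for
    \<open>k = 7\<close>, which is where the 9 in the degree conditions comes from.\<close>
  proof (rule K33_minor_of_large_degree_sums[OF assms(1)])
    show "V \<noteq> {}" using assms(4) by auto
    show "1 \<le> vertex_degree E v" if "v \<in> V" for v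
      by (rule graph_connected_degree_pos[OF assms(1,2,4) that])
    show "vertex_degree E v \<noteq> 5" if "v \<in> V" for v using assms(5) that by blast
    show "9 + card (neighbors E x \<inter> neighbors E y) \<le> vertex_degree E x + vertex_degree E y"
      if "{x, y} \<in> E" for x y
    proof (rule ccontr)
      assume "\<not> ?thesis"
      then have "vertex_degree E x + vertex_degree E y \<le> 7 + 1 + card (neighbors E x \<inter> neighbors E y)" by simp
      from b_dR_le_adjacent[OF assms(1) that this] b show False by blast
    qed
    show "9 \<le> vertex_degree E x + vertex_degree E y"
      if "x \<noteq> y" "{x, z} \<in> E" "{y, z} \<in> E" for x y z
    proof (rule ccontr)
      assume "\<not> ?thesis"
      then have "vertex_degree E x + vertex_degree E y \<le> 7 + 1" by simp
      from b_dR_le_common_neighbor[OF assms(1) that this] b show False by blast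
    qed
  qed
  then show False using planar_graph_no_K33_minor[OF assms(1,3)] by blast
qed

end
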